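(* Let $\mathbf{H}=\sum_{i,j=1}^{3}\epsilon_{ij}\mathbf{C}_{ij}$, where $(\epsilon_{ij})_{1\le i,j\le 3}$ is a Hermitian matrix, be a linear Hermitian Hamiltonian in the generators $C_{ij}$. In the coordinates $z=(z_{12},z_{13},z_{23})\in\mathbb{C}^3$ on $SU(3)/S(U(1)\times U(1)\times U(1))$ given by the parametrization $$V'_+(z)=\begin{pmatrix}1&z_{12}&z_{13}\\0&1&z_{23}\\0&0&1\end{pmatrix},$$ the equations of motion $$i\dot z_{\alpha}=\sum_{i,j=1}^{3}\epsilon_{ij}\,Q_{ij,\alpha}(z),\qquad \alpha\in\{12,13,23\},$$ associated to $\mathbf{H}$ (where $Q_{ij,\alpha}$ is the coefficient of $\partial/\partial z_\alpha$ in the first order differential operator $\mathbb{C}_{ij}$ representing $C_{ij}$, as defined in the context) are $$\begin{aligned} i\dot z_{12}&=-\epsilon_{11}z_{12}+\epsilon_{12}-\epsilon_{21}z_{12}^2+\epsilon_{22}z_{12}-\epsilon_{31}z_{12}z_{13}+\epsilon_{32}z_{13},\\ i\dot z_{13}&=-\epsilon_{11}z_{13}+\epsilon_{13}-\epsilon_{21}z_{12}z_{13}+\epsilon_{23}z_{12}-\epsilon_{31}z_{13}^2+\epsilon_{33}z_{13},\\ i\dot z_{23}&=\epsilon_{21}(z_{12}z_{23}-z_{13})-\epsilon_{22}z_{23}+\epsilon_{23}+\epsilon_{31}(z_{12}z_{23}-z_{13})z_{23}-\epsilon_{32}z_{23}^2+\epsilon_{33}z_{23}. \end{aligned}$$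
   Context: Scalar products are antilinear in the first argument and linear in the second. Generators. $C_{ij}$, $1\le i,j\le 3$, denotes the $3\times 3$ matrix unit with entry $1$ at position $(i,j)$ and $0$ elsewhere, so $[C_{ij},C_{kl}]=\delta_{jk}C_{il}-\delta_{il}C_{kj}$. One has $V'_+(z)=\exp(z_{23}C_{23})\exp(z_{12}C_{12}+z_{13}C_{13})$. Representations. Let $w=(w_1,w_2,w_3)$ be a weight with $w_1-w_2\ge 0$, $w_2-w_3\ge 0$ (integers), and let $\pi_w$ be the corresponding finite-dimensional irreducible representation on a Hilbert space $\mathcal{H}$, unitary for the compact group. Write $\mathbf{C}_{ij}$ for the operator representing $C_{ij}$, so that $\mathbf{C}_{ij}^{*}=\mathbf{C}_{ji}$. Let $\phi_w$ be a unit highest weight vector: $\mathbf{C}_{ij}\phi_w=0$ for $i<j$ and $\mathbf{C}_{ii}\phi_w=w_i\phi_w$. Coherent state vectors. $\phi_z=[\pi_w(V'_+(z))]^{*}\phi_w=\exp(\bar z_{12}\mathbf{C}_{21}+\bar z_{13}\mathbf{C}_{31})\exp(\bar z_{23}\mathbf{C}_{32})\phi_w$ for $z\in\mathbb{C}^3$. To $\psi\in\mathcal{H}$ one associates the holomorphic function $f_\psi(z)=(\phi_z,\psi)$. Differential operators. The generator $C_{ij}$ is represented on the functions $f_\psi$ by the first order differential operator $$\mathbb{C}_{ij}=P_{ij}(z)+\sum_{\alpha\in\{12,13,23\}}Q_{ij,\alpha}(z)\frac{\partial}{\partial z_\alpha}$$ with polynomial coefficients such that $\mathbb{C}_{ij}f_\psi=f_{\mathbf{C}_{ij}\psi}$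 for all $\psi\in\mathcal{H}$. Here $P_{ij}$ may depend on $w$, while the $Q_{ij,\alpha}$ are independent of $w$ (the same for all admissible $w$), which determines them uniquely. *)

theory Defs
  imports "HOL-Analysis.Derivative" "Jordan_Normal_Form.Schur_Decomposition"
begin

text \<open>
  Every finite-dimensional Hilbert space is taken to be \<open>\<complex>\<^sup>n\<close>, represented by
  \<^term>\<open>carrier_vec n :: complex vec set\<close>, so that one formula can quantify over
  representations of all dimensions.  The library product \<^term>\<open>u \<bullet>c v\<close> is antilinear in its
  second argument; \<open>inner_prod\<close> flips it.
\<close>

definition inner_prod :: "complex vec \<Rightarrow> complex vec \<Rightarrow> complex" where
  "inner_prod u v = v \<bullet>c u"

definition mat_exp :: "complex mat \<Rightarrow> complex mat" where
  "mat_exp A = mat (dim_row A) (dim_row A) (\<lambda>(i, j). \<Sum>k. (A ^\<^sub>m k) $$ (i, j) / fact k)"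

datatype coord = Z12 | Z13 | Z23

type_synonym point = "coord \<Rightarrow> complex"

text \<open>Generators are indexed by \<open>i, j \<in> {1..3}\<close>; values of a family at other indices are irrelevant.\<close>

type_synonym generators = "nat \<Rightarrow> nat \<Rightarrow> complex mat"

definition gl3_rep :: "nat \<Rightarrow> generators \<Rightarrow> bool" where
  "gl3_rep n C \<longleftrightarrow>
     (\<forall>i\<in>{1..3}. \<forall>j\<in>{1..3}. C i j \<in> carrier_mat n n) \<and>
     (\<forall>i\<in>{1..3}. \<forall>j\<in>{1..3}. \<forall>k\<in>{1..3}. \<forall>l\<in>{1..3}.
        C i j * C k l - C k l * C i j =
        (if j = k then C i l else 0\<^sub>m n n) - (if i = l then C k j else 0\<^sub>m n n))"

definition irreducible_rep :: "nat \<Rightarrow> generators \<Rightarrow> bool" where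
  "irreducible_rep n C \<longleftrightarrow> gl3_rep n C \<and> n > 0 \<and>
     (\<forall>W. VectorSpace.subspace class_ring W (module_vec TYPE(complex) n) \<longrightarrow>
        (\<forall>i\<in>{1..3}. \<forall>j\<in>{1..3}. \<forall>v\<in>W. C i j *\<^sub>v v \<in> W) \<longrightarrow>
        W = {0\<^sub>v n} \<or> W = carrier_vec n)"

text \<open>
  Infinitesimally, unitarity for the compact group is the condition that the adjoint of
  \<open>C i j\<close> is \<open>C j i\<close>.
\<close>

definition unitary_rep :: "generators \<Rightarrow> bool" where
  "unitary_rep C \<longleftrightarrow> (\<forall>i\<in>{1..3}. \<forall>j\<in>{1..3}. mat_adjoint (C i j) = C j i)"

definition highest_weight_vector ::
  "nat \<Rightarrow> generators \<Rightarrow> (nat \<Rightarrow> real) \<Rightarrow> complex vec \<Rightarrow> bool" where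
  "highest_weight_vector n C w \<phi> \<longleftrightarrow>
     \<phi> \<in> carrier_vec n \<and> inner_prod \<phi> \<phi> = 1 \<and>
     (\<forall>i\<in>{1..3}. \<forall>j\<in>{1..3}. i < j \<longrightarrow> C i j *\<^sub>v \<phi> = 0\<^sub>v n) \<and>
     (\<forall>i\<in>{1..3}. C i i *\<^sub>v \<phi> = complex_of_real (w i) \<cdot>\<^sub>v \<phi>)"

text \<open>
  Only the differences of the weight components are required to be integers: the components of an
  \<open>SU(3)\<close> weight normalised to sum zero are in general multiples of \<open>1/3\<close>.
\<close>

definition admissible_weight :: "(nat \<Rightarrow> real) \<Rightarrow> bool" where
  "admissible_weight w \<longleftrightarrow> w 1 - w 2 \<in> \<nat> \<and> w 2 - w 3 \<in> \<nat>"

definition highest_weight_irrep ::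
  "(nat \<Rightarrow> real) \<Rightarrow> nat \<Rightarrow> generators \<Rightarrow> complex vec \<Rightarrow> bool" where
  "highest_weight_irrep w n C \<phi> \<longleftrightarrow>
     irreducible_rep n C \<and> unitary_rep C \<and> highest_weight_vector n C w \<phi>"

text \<open>
  \<open>V_plus C z\<close> is the operator representing \<open>V'\<^sub>+(z)\<close>; that \<open>V'\<^sub>+(z)\<close> itself is the
  unipotent upper triangular matrix with entries \<open>z\<close> is \<open>V_plus_matrix_units\<close> below.
\<close>

definition V_plus :: "generators \<Rightarrow> point \<Rightarrow> complex mat" where
  "V_plus C z = mat_exp (z Z23 \<cdot>\<^sub>m C 2 3) * mat_exp (z Z12 \<cdot>\<^sub>m C 1 2 + z Z13 \<cdot>\<^sub>m C 1 3)"

definition matrix_unit :: generators where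
  "matrix_unit i j = mat 3 3 (\<lambda>(k, l). if Suc k = i \<and> Suc l = j then 1 else 0)"

definition coherent_state :: "generators \<Rightarrow> complex vec \<Rightarrow> point \<Rightarrow> complex vec" where
  "coherent_state C \<phi> z = mat_adjoint (V_plus C z) *\<^sub>v \<phi>"

definition coherent_fun :: "generators \<Rightarrow> complex vec \<Rightarrow> complex vec \<Rightarrow> point \<Rightarrow> complex" where
  "coherent_fun C \<phi> \<psi> z = inner_prod (coherent_state C \<phi> z) \<psi>"

definition polynomial_fun :: "(point \<Rightarrow> complex) \<Rightarrow> bool" where
  "polynomial_fun g \<longleftrightarrow> (\<exists>(N::nat) (c :: nat \<Rightarrow> nat \<Rightarrow> nat \<Rightarrow> complex). \<forall>z.
     g z = (\<Sum>a\<le>N. \<Sum>b\<le>N. \<Sum>d\<le>N. c a b d * z Z12 ^ a * z Z13 ^ b * z Z23 ^ d))"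

definition pderiv_coord :: "coord \<Rightarrow> (point \<Rightarrow> complex) \<Rightarrow> point \<Rightarrow> complex" where
  "pderiv_coord \<alpha> f z = deriv (\<lambda>t. f (z(\<alpha> := t))) (z \<alpha>)"

definition diff_op ::
  "(point \<Rightarrow> complex) \<Rightarrow> (coord \<Rightarrow> point \<Rightarrow> complex) \<Rightarrow> (point \<Rightarrow> complex) \<Rightarrow> point \<Rightarrow> complex" where
  "diff_op P Q f z = P z * f z + (\<Sum>\<alpha>\<in>{Z12, Z13, Z23}. Q \<alpha> z * pderiv_coord \<alpha> f z)"

text \<open>
  The zeroth order coefficient is chosen after the weight \<open>w\<close>, the first order coefficients
  \<open>Q\<close> before it.
\<close>

definition first_order_coeffs ::
  "nat \<Rightarrow> nat \<Rightarrow> (coord \<Rightarrow> point \<Rightarrow> complex) \<Rightarrow> bool" where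
  "first_order_coeffs i j Q \<longleftrightarrow>
     (\<forall>\<alpha>. polynomial_fun (Q \<alpha>)) \<and>
     (\<forall>w. admissible_weight w \<longrightarrow>
        (\<exists>P. polynomial_fun P \<and>
           (\<forall>n C \<phi>. highest_weight_irrep w n C \<phi> \<longrightarrow>
              (\<forall>\<psi>\<in>carrier_vec n.
                 diff_op P Q (coherent_fun C \<phi> \<psi>) = coherent_fun C \<phi> (C i j *\<^sub>v \<psi>)))))"

definition Q_coeff :: "nat \<Rightarrow> nat \<Rightarrow> coord \<Rightarrow> point \<Rightarrow> complex" where
  "Q_coeff i j = (THE Q. first_order_coeffs i j Q)"

definition hermitian_coeffs :: "(nat \<Rightarrow> nat \<Rightarrow> complex) \<Rightarrow> bool" where
  "hermitian_coeffs \<epsilon> \<longleftrightarrow> (\<forall>i\<in>{1..3}. \<forall>j\<in>{1..3}. \<epsilon> j i = cnj (\<epsilon> i j))"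

text \<open>
  The linear Hamiltonian \<open>\<Sum>i j. \<epsilon> i j C i j\<close> enters through its coefficients only;
  \<open>z'\<close> is the velocity at the point \<open>z\<close>.
\<close>

definition equations_of_motion :: "(nat \<Rightarrow> nat \<Rightarrow> complex) \<Rightarrow> point \<Rightarrow> point \<Rightarrow> bool" where
  "equations_of_motion \<epsilon> z z' \<longleftrightarrow>
     (\<forall>\<alpha>. \<i> * z' \<alpha> = (\<Sum>i = 1..3. \<Sum>j = 1..3. \<epsilon> i j * Q_coeff i j \<alpha> z))"

lemma mat_exp_square_zero:
  assumes A: "A \<in> carrier_mat n n" and sq: "A * A = 0\<^sub>m n n"
  shows "mat_exp A = 1\<^sub>m n + A"
proof -
  have pow: "A ^\<^sub>m (Suc (Suc k)) = 0\<^sub>m n n" for k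
  proof (induction k)
    case 0
    then show ?case using A sq by simp
  next
    case (Suc k)
    then show ?case using A by simp
  qed
  have "(\<Sum>k. (A ^\<^sub>m k) $$ (i, j) / fact k) = (1\<^sub>m n + A) $$ (i, j)"
    if ij: "i < n" "j < n" for i j
  proof -
    have z: "(A ^\<^sub>m k) $$ (i, j) / fact k = 0" if k: "k \<notin> {0, 1}" for k
    proof -
      have "Suc (Suc (k - 2)) = k"
        using k by auto
      then have "A ^\<^sub>m k = 0\<^sub>m n n"
        using pow[of "k - 2"] by (rule subst)
      then show ?thesis
        using ij by simp
    qed
    have "(\<Sum>k. (A ^\<^sub>m k) $$ (i, j) / fact k) = (\<Sum>k\<in>{0, 1}. (A ^\<^sub>m k) $$ (i, j) / fact k)"
      by (rule suminf_finite) (use z in auto)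
    then show ?thesis
      using A ij by simp
  qed
  then show ?thesis
    using A by (intro eq_matI) (auto simp: mat_exp_def)
qed

lemma V_plus_matrix_units:
  "V_plus matrix_unit z =
     mat_of_rows_list 3 [[1, z Z12, z Z13], [0, 1, z Z23], [0, 0, 1]]"
proof -
  have lt3: "i < 3 \<longleftrightarrow> i = 0 \<or> i = 1 \<or> i = (2::nat)" for i
    by auto
  have set3: "{0..<3::nat} = {0, 1, 2}"
    by auto
  have A: "z Z23 \<cdot>\<^sub>m matrix_unit 2 3 \<in> carrier_mat 3 3" (is "?A \<in> _")
    and B: "z Z12 \<cdot>\<^sub>m matrix_unit 1 2 + z Z13 \<cdot>\<^sub>m matrix_unit 1 3 \<in> carrier_mat 3 3" (is "?B \<in> _")
    by (simp_all add: matrix_unit_def)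
  have "?A * ?A = 0\<^sub>m 3 3"
    by (rule eq_matI) (auto simp: matrix_unit_def scalar_prod_def set3 lt3)
  then have eA: "mat_exp ?A = 1\<^sub>m 3 + ?A"
    by (rule mat_exp_square_zero[OF A])
  have "?B * ?B = 0\<^sub>m 3 3"
    by (rule eq_matI) (auto simp: matrix_unit_def scalar_prod_def set3 lt3)
  then have eB: "mat_exp ?B = 1\<^sub>m 3 + ?B"
    by (rule mat_exp_square_zero[OF B])
  have prod: "(1\<^sub>m 3 + ?A) * (1\<^sub>m 3 + ?B) =
      mat_of_rows_list 3 [[1, z Z12, z Z13], [0, 1, z Z23], [0, 0, 1]]" (is "?L = ?R")
  proof (rule eq_matI)
    fix i j
    assume "i < dim_row ?R" "j < dim_col ?R"
    then have "i = 0 \<or> i = 1 \<or> i = 2" "j = 0 \<or> j = 1 \<or> j = 2"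
      by (auto simp: mat_of_rows_list_def)
    then show "?L $$ (i, j) = ?R $$ (i, j)"
      by (elim disjE)
        (simp_all add: matrix_unit_def scalar_prod_def set3 mat_of_rows_list_def)
  qed (simp_all add: matrix_unit_def mat_of_rows_list_def)
  show ?thesis
    unfolding V_plus_def eA eB by (rule prod)
qed

end

(*
  The operator C i j is pulled through V_plus C z: since V' E_ij V'^(-1) is a combination of matrix
  units with polynomial coefficients, V_plus C z * C i j is the same combination of generators times
  V_plus C z.  Paired with the highest weight vector, the lowering generators vanish, the diagonal ones
  give weights, and the raising ones are derivatives of V_plus along the coordinates.  This yields
  Q_ij in terms of the entries of V' and of its inverse.

  For uniqueness, the defining representation, whose functions are 1, z12 and z13, determines Q12 and
  Q13; it does not see z23, and the contragredient representation, whose functions include 1 and -z23,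
  determines Q23.
*)
theory Submission
  imports Defs
begin

section \<open>Polynomial functions\<close>

text \<open>In an arbitrary representation the entries of \<open>V_plus C z\<close> are out of
  reach, so everything has to follow from commutators. Two facts keep this finite. Both exponents in
  V', regarded as 3x3 matrices, have square zero; hence triple commutators with them vanish, and
  conjugation by their exponentials stops at second order in every representation. Their operators
  are also nilpotent, since each is an eigenvector of a diagonal generator under commutation, and
  the vanishing exponent can be bounded independently of the coordinates. All exponential series are
  therefore finite sums of fixed length, which may be multiplied and differentiated term by term.
  The two factors of V' do not commute: differentiating along z12 produces \<open>C 1 2\<close>
  minus z23 times \<open>C 1 3\<close>, which is why the coefficient of the z13 derivative carries a
  term with z23. In the uniqueness argument the constant function 1 is what separates the zeroth
  order coefficient, which may vary with the weight, from the derivatives.\<close>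

lemma if_zero_mult: "(if P then x else 0) * y = (if P then x * y else (0 :: 'a :: mult_zero))"
  by simp

lemma sum_if_zero: "(\<Sum>x\<in>S. if P then f x else 0) = (if P then sum f S else 0)"
  by simp

lemma sum_atMost_truncate:
  assumes "N \<le> M"
  shows "(\<Sum>k\<le>M. if k \<le> N then f k else 0) = (\<Sum>k\<le>(N :: nat). f k :: 'a :: comm_monoid_add)"
proof -
  have "{..M} \<inter> {k. k \<le> N} = {..N}"
    using assms by auto
  then show ?thesis
    by (simp add: sum.If_cases)
qed

lemma polynomial_fun_monomial:
  "polynomial_fun (\<lambda>z. c * z Z12 ^ a * z Z13 ^ b * z Z23 ^ d)"
  unfolding polynomial_fun_def
proof (intro exI allI)
  fix z :: point
  \<comment> \<open>A single bound governs all three exponents; the sum dominates each of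
    them.\<close>
  let ?N = "a + b + d"
  \<comment> \<open>The conditions are nested instead of conjoined so that each can be pulled out of
    the sums that do not bind its index.\<close>
  let ?c = "\<lambda>a' b' d'. if a' = a then if b' = b then if d' = d then c else 0 else 0 else 0"
  have delta: "(\<Sum>k\<le>?N. if k = i then f k else 0) = f i" if "i \<le> ?N" for i and f :: "nat \<Rightarrow> complex"
    using that by simp
  have "a \<le> ?N" "b \<le> ?N" "d \<le> ?N"
    by simp_all
  then show "c * z Z12 ^ a * z Z13 ^ b * z Z23 ^ d =
      (\<Sum>a'\<le>?N. \<Sum>b'\<le>?N. \<Sum>d'\<le>?N. ?c a' b' d' * z Z12 ^ a' * z Z13 ^ b' * z Z23 ^ d')"
    by (simp only: if_zero_mult sum_if_zero delta)
qed

text \<open>The degree bounds of the two summands may differ, so both coefficient arrays are padded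
  with zeros up to the larger bound and then added.\<close>

lemma polynomial_fun_add:
  assumes "polynomial_fun f" "polynomial_fun g"
  shows "polynomial_fun (\<lambda>z. f z + g z)"
proof -
  let ?T = "\<lambda>(c :: nat \<Rightarrow> nat \<Rightarrow> nat \<Rightarrow> complex) z a b d. c a b d * z Z12 ^ a * z Z13 ^ b * z Z23 ^ d"
  have pad: "\<exists>c'. \<forall>z. h z = (\<Sum>a\<le>M. \<Sum>b\<le>M. \<Sum>d\<le>M. ?T c' z a b d)"
    if h: "\<And>z. h z = (\<Sum>a\<le>N. \<Sum>b\<le>N. \<Sum>d\<le>N. ?T c z a b d)" and NM: "N \<le> M"
    for h :: "point \<Rightarrow> complex" and N M c
    by (rule exI[of _ "\<lambda>a b d. if a \<le> N then if b \<le> N then if d \<le> N then c a b d else 0 else 0 else 0"])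
      (simp only: h if_zero_mult sum_if_zero sum_atMost_truncate[OF NM] simp_thms)
  obtain N c where f: "\<And>z. f z = (\<Sum>a\<le>N. \<Sum>b\<le>N. \<Sum>d\<le>N. ?T c z a b d)"
    using assms(1) unfolding polynomial_fun_def by blast
  obtain N' c' where g: "\<And>z. g z = (\<Sum>a\<le>N'. \<Sum>b\<le>N'. \<Sum>d\<le>N'. ?T c' z a b d)"
    using assms(2) unfolding polynomial_fun_def by blast
  obtain e where e: "\<And>z. f z = (\<Sum>a\<le>max N N'. \<Sum>b\<le>max N N'. \<Sum>d\<le>max N N'. ?T e z a b d)"
    using pad[OF f, of "max N N'"] by auto
  obtain e' where e': "\<And>z. g z = (\<Sum>a\<le>max N N'. \<Sum>b\<le>max N N'. \<Sum>d\<le>max N N'. ?T e' z a b d)"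
    using pad[OF g, of "max N N'"] by auto
  show ?thesis
    unfolding polynomial_fun_def e e'
    by (rule exI[of _ "max N N'"], rule exI[of _ "\<lambda>a b d. e a b d + e' a b d"])
      (simp add: sum.distrib algebra_simps)
qed

lemma polynomial_fun_const: "polynomial_fun (\<lambda>z. c)"
  using polynomial_fun_monomial[of c 0 0 0] by simp

lemma polynomial_fun_coord: "polynomial_fun (\<lambda>z. z \<alpha>)"
  using polynomial_fun_monomial[of 1 1 0 0] polynomial_fun_monomial[of 1 0 1 0]
    polynomial_fun_monomial[of 1 0 0 1]
  by (cases \<alpha>) simp_all

lemma polynomial_fun_sum:
  assumes "\<And>x. x \<in> S \<Longrightarrow> polynomial_fun (f x)"
  shows "polynomial_fun (\<lambda>z. \<Sum>x\<in>S. f x z)"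
  using assms
  by (induction S rule: infinite_finite_induct)
    (simp_all add: polynomial_fun_const polynomial_fun_add)

text \<open>Expanding both triple sums leaves a finite sum of products of monomials, so the
  convolved coefficient array never has to be written down.\<close>

lemma polynomial_fun_mult:
  assumes "polynomial_fun f" "polynomial_fun g"
  shows "polynomial_fun (\<lambda>z. f z * g z)"
proof -
  obtain N c where f: "\<And>z. f z = (\<Sum>a\<le>N. \<Sum>b\<le>N. \<Sum>d\<le>N.
      c a b d * z Z12 ^ a * z Z13 ^ b * z Z23 ^ d)"
    using assms(1) unfolding polynomial_fun_def by blast
  obtain N' c' where g: "\<And>z. g z = (\<Sum>a\<le>N'. \<Sum>b\<le>N'. \<Sum>d\<le>N'.
      c' a b d * z Z12 ^ a * z Z13 ^ b * z Z23 ^ d)"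
    using assms(2) unfolding polynomial_fun_def by blast
  have "polynomial_fun (\<lambda>z. (c a b d * z Z12 ^ a * z Z13 ^ b * z Z23 ^ d) *
      (c' a' b' d' * z Z12 ^ a' * z Z13 ^ b' * z Z23 ^ d'))" for a b d a' b' d'
    using polynomial_fun_monomial[of "c a b d * c' a' b' d'" "a + a'" "b + b'" "d + d'"]
    by (simp add: power_add algebra_simps)
  then show ?thesis
    unfolding f g by (simp only: sum_distrib_left sum_distrib_right polynomial_fun_sum)
qed

lemma polynomial_fun_uminus:
  assumes "polynomial_fun f"
  shows "polynomial_fun (\<lambda>z. - f z)"
  using polynomial_fun_mult[OF polynomial_fun_const[of "-1"] assms] by simp

lemma polynomial_fun_diff:
  assumes "polynomial_fun f" "polynomial_fun g"
  shows "polynomial_fun (\<lambda>z. f z - g z)"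
  using polynomial_fun_add[OF assms(1) polynomial_fun_uminus[OF assms(2)]] by simp

section \<open>Exponentials of nilpotent matrices\<close>

lemma mult_mat_entry:
  assumes "A \<in> carrier_mat n n" "B \<in> carrier_mat n n" "p < n" "q < n"
  shows "(A * B) $$ (p, q) = (\<Sum>r<n. A $$ (p, r) * B $$ (r, q))"
  using assms by (auto simp: scalar_prod_def atLeast0LessThan intro!: sum.cong)

text \<open>Commutation with \<open>H\<close> is a derivation, so each of the \<open>k\<close>
  factors \<open>X\<close> contributes one copy of the power.\<close>

lemma pow_mat_commute_eigen:
  fixes H X :: "complex mat"
  assumes H: "H \<in> carrier_mat n n" and X: "X \<in> carrier_mat n n"
    and HX: "H * X = X + X * H"
  shows "H * X ^\<^sub>m k = of_nat k \<cdot>\<^sub>m X ^\<^sub>m k + X ^\<^sub>m k * H"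
proof (induction k)
  case 0
  then show ?case using H X by (auto intro!: eq_matI)
next
  case (Suc k)
  have P: "X ^\<^sub>m k \<in> carrier_mat n n"
    using X by simp
  note rules = mult_carrier_mat[of _ n n _ n] smult_carrier_mat assoc_mult_mat[of _ n n _ n _ n] add_mult_distrib_mat[where nr = n and n = n and nc = n]
    mult_add_distrib_mat[of _ n n _ n _] mult_smult_assoc_mat[of _ n n _ n]
  have "H * X ^\<^sub>m Suc k = (H * X ^\<^sub>m k) * X"
    using H X P by (simp add: rules)
  also have "\<dots> = (of_nat k \<cdot>\<^sub>m (X ^\<^sub>m k * X)) + X ^\<^sub>m k * (H * X)"
    unfolding Suc using H X P by (simp add: rules)
  also have "\<dots> = (of_nat k \<cdot>\<^sub>m (X ^\<^sub>m k * X)) + (X ^\<^sub>m k * X + X ^\<^sub>m k * X * H)"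
    unfolding HX using H X P by (simp add: rules)
  also have "\<dots> = of_nat (Suc k) \<cdot>\<^sub>m X ^\<^sub>m Suc k + X ^\<^sub>m Suc k * H"
    using H X P by (intro eq_matI) (simp_all add: algebra_simps)
  finally show ?case .
qed

text \<open>
  \<open>X ^ k\<close> is an eigenvector of \<open>ad H\<close> with eigenvalue \<open>k\<close>, which exceeds the operator norm of
  \<open>ad H\<close> for large \<open>k\<close>.
\<close>

lemma ad_eigenvector_nilpotent:
  fixes H :: "complex mat"
  assumes H: "H \<in> carrier_mat n n"
  shows "\<exists>K. \<forall>X \<in> carrier_mat n n. H * X = X + X * H \<longrightarrow> (\<forall>k\<ge>K. X ^\<^sub>m k = 0\<^sub>m n n)"
proof -
  \<comment> \<open>The inserted \<open>0\<close> keeps the set nonempty when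
    \<open>n = 0\<close>.\<close>
  define h where "h = Max (insert 0 ((\<lambda>(p, q). cmod (H $$ (p, q))) ` ({..<n} \<times> {..<n})))"
  have h: "cmod (H $$ (p, q)) \<le> h" if "p < n" "q < n" for p q
    unfolding h_def using that by (intro Max_ge) (auto intro!: rev_image_eqI[of "(p, q)"])
  \<comment> \<open>A commutator with \<open>H\<close> enlarges the maximal entry of a matrix by a
    factor of at most \<open>2 * n * h\<close>: two products, each a sum of \<open>n\<close> terms.
    This \<open>K\<close> depends on \<open>H\<close> only and so serves every
    \<open>X\<close>.\<close>
  obtain K :: nat where K: "2 * real n * h < real K"
    using reals_Archimedean2 by blast
  have "X ^\<^sub>m k = 0\<^sub>m n n" if X: "X \<in> carrier_mat n n" and HX: "H * X = X + X * H" and k: "k \<ge> K" for X k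
  proof -
    define Y where "Y = X ^\<^sub>m k"
    have Y: "Y \<in> carrier_mat n n"
      using X by (simp add: Y_def)
    define S where "S = insert 0 ((\<lambda>(p, q). cmod (Y $$ (p, q))) ` ({..<n} \<times> {..<n}))"
    define m where "m = Max S"
    have fin: "finite S"
      by (simp add: S_def)
    have m: "cmod (Y $$ (p, q)) \<le> m" if "p < n" "q < n" for p q
      unfolding m_def using that fin by (intro Max_ge) (auto simp: S_def intro!: rev_image_eqI[of "(p, q)"])
    have m0: "0 \<le> m"
      unfolding m_def using fin by (intro Max_ge) (auto simp: S_def)
    have bound: "real k * cmod (Y $$ (p, q)) \<le> 2 * real n * h * m" if pq: "p < n" "q < n" for p q
    proof -
      have "(H * Y) $$ (p, q) = of_nat k * Y $$ (p, q) + (Y * H) $$ (p, q)"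
        using arg_cong[OF pow_mat_commute_eigen[OF H X HX, of k], of "\<lambda>M. M $$ (p, q)"] pq H Y
        by (simp add: Y_def[symmetric])
      then have "of_nat k * Y $$ (p, q) = (\<Sum>r<n. H $$ (p, r) * Y $$ (r, q) - Y $$ (p, r) * H $$ (r, q))"
        using mult_mat_entry[OF H Y pq] mult_mat_entry[OF Y H pq] by (simp add: sum_subtractf)
      then have "real k * cmod (Y $$ (p, q)) =
          cmod (\<Sum>r<n. H $$ (p, r) * Y $$ (r, q) - Y $$ (p, r) * H $$ (r, q))"
        by (metis norm_mult norm_of_nat)
      also have "\<dots> \<le> (\<Sum>r<n. h * m + m * h)"
      proof (rule sum_norm_le)
        fix r assume "r \<in> {..<n}"
        then have r: "r < n" by simp
        have "cmod (H $$ (p, r)) * cmod (Y $$ (r, q)) \<le> h * m"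
          using h[OF pq(1) r] m[OF r pq(2)] order_trans[OF norm_ge_zero h[OF pq(1) r]]
          by (intro mult_mono) auto
        moreover have "cmod (Y $$ (p, r)) * cmod (H $$ (r, q)) \<le> m * h"
          using m[OF pq(1) r] h[OF r pq(2)] m0 by (intro mult_mono) auto
        ultimately show "cmod (H $$ (p, r) * Y $$ (r, q) - Y $$ (p, r) * H $$ (r, q)) \<le> h * m + m * h"
          by (metis (no_types, lifting) add_mono norm_mult norm_triangle_ineq4 order_trans)
      qed
      finally show ?thesis
        by (simp add: algebra_simps)
    qed
    have "m = 0"
    proof (rule ccontr)
      assume "m \<noteq> 0"
      then have "m \<in> S - {0}"
        unfolding m_def using Max_in[OF fin] by (auto simp: S_def)
      then obtain p q where "p < n" "q < n" "m = cmod (Y $$ (p, q))"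
        by (auto simp: S_def)
      then have "real k * m \<le> 2 * real n * h * m"
        using bound by blast
      moreover have "2 * real n * h * m < real k * m"
        using K k \<open>m \<noteq> 0\<close> m0 by (intro mult_strict_right_mono) auto
      ultimately show False
        by simp
    qed
    then have "Y $$ (p, q) = 0" if "p < n" "q < n" for p q
      using m[OF that] by simp
    then show ?thesis
      using Y unfolding Y_def[symmetric] by (intro eq_matI) auto
  qed
  then show ?thesis
    by blast
qed

section \<open>Conjugation by the exponential of a nilpotent matrix\<close>

lemma mat_exp_carrier: "X \<in> carrier_mat n n \<Longrightarrow> mat_exp X \<in> carrier_mat n n"
  by (simp add: mat_exp_def)

lemma mat_exp_nilpotent_entry:
  assumes X: "X \<in> carrier_mat n n" and nil: "\<And>k. k \<ge> K \<Longrightarrow> X ^\<^sub>m k = 0\<^sub>m n n"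
    and pq: "p < n" "q < n"
  shows "mat_exp X $$ (p, q) = (\<Sum>k<K. (X ^\<^sub>m k) $$ (p, q) / fact k)"
proof -
  have "(\<Sum>k. (X ^\<^sub>m k) $$ (p, q) / fact k) = (\<Sum>k<K. (X ^\<^sub>m k) $$ (p, q) / fact k)"
    using nil pq by (intro suminf_finite) (auto simp: not_less)
  then show ?thesis
    using X pq by (simp add: mat_exp_def)
qed

lemma pow_mat_commute:
  fixes X N :: "complex mat"
  assumes X: "X \<in> carrier_mat n n" and N: "N \<in> carrier_mat n n" and XN: "X * N = N * X"
  shows "X ^\<^sub>m k * N = N * X ^\<^sub>m k"
proof (induction k)
  case 0
  then show ?case using X N by simp
next
  case (Suc k)
  have P: "X ^\<^sub>m k \<in> carrier_mat n n"
    using X by simp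
  have "X ^\<^sub>m Suc k * N = X ^\<^sub>m k * (X * N)"
    using X N P by (simp add: assoc_mult_mat[of _ n n _ n _ n])
  also have "\<dots> = X ^\<^sub>m k * (N * X)"
    unfolding XN ..
  also have "\<dots> = (X ^\<^sub>m k * N) * X"
    using X N P by (simp add: assoc_mult_mat[of _ n n _ n _ n])
  also have "\<dots> = N * X ^\<^sub>m Suc k"
    unfolding Suc using X N P by (simp add: assoc_mult_mat[of _ n n _ n _ n])
  finally show ?case .
qed

text \<open>Carrying \<open>N\<close> to the left past each factor \<open>X\<close> leaves behind
  one \<open>N'\<close>, which commutes with the rest. The exponent is a successor so that the lower
  power needs no subtraction.\<close>

lemma pow_mat_commute1:
  fixes X N N' :: "complex mat"
  assumes X: "X \<in> carrier_mat n n" and N: "N \<in> carrier_mat n n" and N': "N' \<in> carrier_mat n n"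
    and XN: "X * N = N * X + N'" and XN': "X * N' = N' * X"
  shows "X ^\<^sub>m Suc k * N = N * X ^\<^sub>m Suc k + of_nat (Suc k) \<cdot>\<^sub>m (N' * X ^\<^sub>m k)"
proof (induction k)
  case 0
  then show ?case using X N N' XN by (auto intro!: eq_matI)
next
  case (Suc k)
  have P: "X ^\<^sub>m k \<in> carrier_mat n n" and PS: "X ^\<^sub>m Suc k \<in> carrier_mat n n"
    using X by (simp_all only: pow_carrier_mat)
  note rules = mult_carrier_mat[of _ n n _ n] smult_carrier_mat assoc_mult_mat[of _ n n _ n _ n] add_mult_distrib_mat[where nr = n and n = n and nc = n]
    mult_add_distrib_mat[of _ n n _ n _] mult_smult_assoc_mat[of _ n n _ n]
  have "X ^\<^sub>m Suc (Suc k) * N = X ^\<^sub>m Suc k * (X * N)"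
    using X N PS by (simp add: rules)
  also have "\<dots> = X ^\<^sub>m Suc k * (N * X + N')"
    unfolding XN ..
  also have "\<dots> = (X ^\<^sub>m Suc k * N) * X + X ^\<^sub>m Suc k * N'"
    using X N N' PS by (simp add: rules)
  also have "\<dots> = (N * X ^\<^sub>m Suc k + of_nat (Suc k) \<cdot>\<^sub>m (N' * X ^\<^sub>m k)) * X + N' * X ^\<^sub>m Suc k"
    using Suc pow_mat_commute[OF X N' XN'] by metis
  also have "\<dots> = N * X ^\<^sub>m Suc (Suc k) + of_nat (Suc k) \<cdot>\<^sub>m (N' * X ^\<^sub>m Suc k) + N' * X ^\<^sub>m Suc k"
    using X N N' P by (simp add: rules)
  also have "\<dots> = N * X ^\<^sub>m Suc (Suc k) + of_nat (Suc (Suc k)) \<cdot>\<^sub>m (N' * X ^\<^sub>m Suc k)"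
    using X N N' by (intro eq_matI) (simp_all add: algebra_simps)
  finally show ?case .
qed

text \<open>The Leibniz expansion with \<open>N\<close> the commutator of \<open>X\<close> and
  \<open>M\<close>, and \<open>N'\<close> that of \<open>X\<close> and \<open>N\<close>. The
  coefficients are the binomials of k+2 over 0, 1 and 2; no further ones occur because
  \<open>N'\<close> commutes with \<open>X\<close>.\<close>

lemma pow_mat_commute2:
  fixes X M N N' :: "complex mat"
  assumes X: "X \<in> carrier_mat n n" and M: "M \<in> carrier_mat n n"
    and N: "N \<in> carrier_mat n n" and N': "N' \<in> carrier_mat n n"
    and XM: "X * M = M * X + N" and XN: "X * N = N * X + N'" and XN': "X * N' = N' * X"
  shows "X ^\<^sub>m Suc (Suc k) * M = M * X ^\<^sub>m Suc (Suc k) + of_nat (Suc (Suc k)) \<cdot>\<^sub>m (N * X ^\<^sub>m Suc k)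
    + (of_nat (Suc (Suc k)) * of_nat (Suc k) / 2) \<cdot>\<^sub>m (N' * X ^\<^sub>m k)"
proof (induction k)
  case 0
  have "X ^\<^sub>m Suc (Suc 0) * M = X * (X * M)"
    using X M by (simp add: assoc_mult_mat[of _ n n _ n _ n])
  also have "\<dots> = X * (M * X + N)"
    unfolding XM ..
  also have "\<dots> = X * M * X + X * N"
    using X M N
    by (simp add: assoc_mult_mat[of _ n n _ n _ n] mult_add_distrib_mat[of _ n n _ n _])
  also have "\<dots> = (M * X + N) * X + (N * X + N')"
    unfolding XM XN ..
  also have "\<dots> = M * (X * X) + N * X + (N * X + N')"
    using X M N N' by (simp add: assoc_mult_mat[of _ n n _ n _ n] add_mult_distrib_mat[where nr = n and n = n and nc = n])
  finally show ?case
    using X M N N' by (intro eq_matI) simp_all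
next
  case (Suc k)
  have P: "X ^\<^sub>m k \<in> carrier_mat n n" and PS: "X ^\<^sub>m Suc (Suc k) \<in> carrier_mat n n"
    using X by (simp_all only: pow_carrier_mat)
  note rules = mult_carrier_mat[of _ n n _ n] smult_carrier_mat assoc_mult_mat[of _ n n _ n _ n] add_mult_distrib_mat[where nr = n and n = n and nc = n]
    mult_add_distrib_mat[of _ n n _ n _] mult_smult_assoc_mat[of _ n n _ n]
  let ?c = "of_nat (Suc (Suc k)) * of_nat (Suc k) / 2 :: complex"
  have "X ^\<^sub>m Suc (Suc (Suc k)) * M = X ^\<^sub>m Suc (Suc k) * (X * M)"
    using X M PS by (simp add: rules)
  also have "\<dots> = X ^\<^sub>m Suc (Suc k) * (M * X + N)"
    unfolding XM ..
  also have "\<dots> = (X ^\<^sub>m Suc (Suc k) * M) * X + X ^\<^sub>m Suc (Suc k) * N"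
    using X M N PS by (simp add: rules)
  also have "\<dots> = (M * X ^\<^sub>m Suc (Suc k) + of_nat (Suc (Suc k)) \<cdot>\<^sub>m (N * X ^\<^sub>m Suc k)
      + ?c \<cdot>\<^sub>m (N' * X ^\<^sub>m k)) * X
      + (N * X ^\<^sub>m Suc (Suc k) + of_nat (Suc (Suc k)) \<cdot>\<^sub>m (N' * X ^\<^sub>m Suc k))"
    unfolding Suc pow_mat_commute1[OF X N N' XN XN'] ..
  also have "\<dots> = M * X ^\<^sub>m Suc (Suc (Suc k)) + of_nat (Suc (Suc k)) \<cdot>\<^sub>m (N * X ^\<^sub>m Suc (Suc k))
      + ?c \<cdot>\<^sub>m (N' * X ^\<^sub>m Suc k)
      + (N * X ^\<^sub>m Suc (Suc k) + of_nat (Suc (Suc k)) \<cdot>\<^sub>m (N' * X ^\<^sub>m Suc k))"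
    using X M N N' P by (simp add: rules)
  also have "\<dots> = M * X ^\<^sub>m Suc (Suc (Suc k))
      + of_nat (Suc (Suc (Suc k))) \<cdot>\<^sub>m (N * X ^\<^sub>m Suc (Suc k))
      + (of_nat (Suc (Suc (Suc k))) * of_nat (Suc (Suc k)) / 2) \<cdot>\<^sub>m (N' * X ^\<^sub>m Suc k)"
    using X M N N' by (intro eq_matI) (simp_all del: pow_mat.simps index_mult_mat(1) add: field_simps)
  finally show ?case .
qed

lemma mat_exp_mult_entry:
  assumes X: "X \<in> carrier_mat n n" and M: "M \<in> carrier_mat n n"
    and nil: "\<And>k. k \<ge> K \<Longrightarrow> X ^\<^sub>m k = 0\<^sub>m n n"
    and pq: "p < n" "q < n"
  shows "(mat_exp X * M) $$ (p, q) = (\<Sum>k<K. (X ^\<^sub>m k * M) $$ (p, q) / fact k)"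
    and "(M * mat_exp X) $$ (p, q) = (\<Sum>k<K. (M * X ^\<^sub>m k) $$ (p, q) / fact k)"
proof -
  have E: "mat_exp X \<in> carrier_mat n n" and P: "\<And>k. X ^\<^sub>m k \<in> carrier_mat n n"
    using X by (simp_all add: mat_exp_carrier)
  have "(mat_exp X * M) $$ (p, q) = (\<Sum>r<n. (\<Sum>k<K. (X ^\<^sub>m k) $$ (p, r) / fact k) * M $$ (r, q))"
    unfolding mult_mat_entry[OF E M pq]
    using mat_exp_nilpotent_entry[OF X nil pq(1)] by (intro sum.cong) auto
  also have "\<dots> = (\<Sum>k<K. (X ^\<^sub>m k * M) $$ (p, q) / fact k)"
    unfolding mult_mat_entry[OF P M pq] sum_distrib_right sum_divide_distrib
    by (subst sum.swap) simp
  finally show "(mat_exp X * M) $$ (p, q) = (\<Sum>k<K. (X ^\<^sub>m k * M) $$ (p, q) / fact k)" .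
  have "(M * mat_exp X) $$ (p, q) = (\<Sum>r<n. M $$ (p, r) * (\<Sum>k<K. (X ^\<^sub>m k) $$ (r, q) / fact k))"
    unfolding mult_mat_entry[OF M E pq]
    using mat_exp_nilpotent_entry[OF X nil _ pq(2)] by (intro sum.cong) auto
  also have "\<dots> = (\<Sum>k<K. (M * X ^\<^sub>m k) $$ (p, q) / fact k)"
    unfolding mult_mat_entry[OF M P pq] sum_distrib_left sum_divide_distrib
    by (subst sum.swap) simp
  finally show "(M * mat_exp X) $$ (p, q) = (\<Sum>k<K. (M * X ^\<^sub>m k) $$ (p, q) / fact k)" .
qed

text \<open>This is exp(X) M exp(-X) = exp(ad X) M, where the right-hand series ends with the second
  commutator. Keeping the exponential on the right avoids any discussion of its inverse.\<close>

lemma mat_exp_conjugate: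
  fixes X M N N' :: "complex mat"
  assumes X: "X \<in> carrier_mat n n" and M: "M \<in> carrier_mat n n"
    and N: "N \<in> carrier_mat n n" and N': "N' \<in> carrier_mat n n"
    and XM: "X * M = M * X + N" and XN: "X * N = N * X + N'" and XN': "X * N' = N' * X"
    and nil: "\<And>k. k \<ge> K \<Longrightarrow> X ^\<^sub>m k = 0\<^sub>m n n"
  shows "mat_exp X * M = (M + N + (1/2) \<cdot>\<^sub>m N') * mat_exp X"
proof (rule eq_matI)
  have E: "mat_exp X \<in> carrier_mat n n" and P: "\<And>k. X ^\<^sub>m k \<in> carrier_mat n n"
    using X by (simp_all add: mat_exp_carrier)
  show "dim_row (mat_exp X * M) = dim_row ((M + N + (1/2) \<cdot>\<^sub>m N') * mat_exp X)"
    "dim_col (mat_exp X * M) = dim_col ((M + N + (1/2) \<cdot>\<^sub>m N') * mat_exp X)"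
    using E M N N' by simp_all
  fix p q
  assume "p < dim_row ((M + N + (1/2) \<cdot>\<^sub>m N') * mat_exp X)"
    "q < dim_col ((M + N + (1/2) \<cdot>\<^sub>m N') * mat_exp X)"
  then have pq: "p < n" "q < n"
    using E N' by simp_all
  let ?m = "\<lambda>k. (M * X ^\<^sub>m k) $$ (p, q) / fact k"
  let ?n = "\<lambda>k. (N * X ^\<^sub>m k) $$ (p, q) / fact k"
  let ?n' = "\<lambda>k. (N' * X ^\<^sub>m k) $$ (p, q) / fact k"
  \<comment> \<open>Division by the factorial of k+2 turns the binomial coefficients into the
    inverse factorials of k+2, k+1 and k, so three shifted exponential series appear.\<close>
  have step: "(X ^\<^sub>m Suc (Suc k) * M) $$ (p, q) / fact (Suc (Suc k)) =
      ?m (Suc (Suc k)) + ?n (Suc k) + 1/2 * ?n' k" for k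
  proof -
    have "(X ^\<^sub>m Suc (Suc k) * M) $$ (p, q) = (M * X ^\<^sub>m Suc (Suc k)) $$ (p, q) +
        of_nat (Suc (Suc k)) * (N * X ^\<^sub>m Suc k) $$ (p, q) +
        of_nat (Suc (Suc k)) * of_nat (Suc k) / 2 * (N' * X ^\<^sub>m k) $$ (p, q)"
      unfolding pow_mat_commute2[OF X M N N' XM XN XN']
      using pq X M N N'
      by (simp del: pow_mat.simps index_mult_mat(1))
    moreover have "of_nat (Suc (Suc k)) \<noteq> (0 :: complex)" "of_nat (Suc k) \<noteq> (0 :: complex)"
      by (simp_all only: of_nat_eq_0_iff)
    ultimately show ?thesis
      by (simp add: fact_Suc divide_simps del: pow_mat.simps index_mult_mat(1) of_nat_Suc)
  qed
  \<comment> \<open>Two terms beyond \<open>K\<close> are included, so that after the shifts by one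
    and two the series for \<open>N\<close> and \<open>N'\<close> still reach the index from which
    all powers vanish.\<close>
  have "(mat_exp X * M) $$ (p, q) = (\<Sum>k<Suc (Suc K). (X ^\<^sub>m k * M) $$ (p, q) / fact k)"
    by (rule mat_exp_mult_entry[OF X M _ pq]) (simp add: nil del: pow_mat.simps)
  also have "\<dots> = M $$ (p, q) + (X * M) $$ (p, q) +
      (\<Sum>k<K. ?m (Suc (Suc k)) + ?n (Suc k) + 1/2 * ?n' k)"
    unfolding sum.lessThan_Suc_shift step using X M by (simp del: index_mult_mat(1))
  also have "\<dots> = (\<Sum>k<Suc (Suc K). ?m k) + (\<Sum>k<Suc K. ?n k) + 1/2 * (\<Sum>k<K. ?n' k)"
    unfolding sum.lessThan_Suc_shift XM sum.distrib sum_distrib_left using X M N pq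
    by (simp del: index_mult_mat(1))
  also have "\<dots> = (M * mat_exp X) $$ (p, q) + (N * mat_exp X) $$ (p, q) + 1/2 * (N' * mat_exp X) $$ (p, q)"
    using mat_exp_mult_entry(2)[OF X M _ pq, of "Suc (Suc K)"]
      mat_exp_mult_entry(2)[OF X N _ pq, of "Suc K"] mat_exp_mult_entry(2)[OF X N' _ pq, of K]
    by (simp add: nil del: pow_mat.simps index_mult_mat(1))
  also have "\<dots> = ((M + N + (1/2) \<cdot>\<^sub>m N') * mat_exp X) $$ (p, q)"
    using M N N' E pq
    by (simp add: add_mult_distrib_mat[where nr = n and n = n and nc = n]
        mult_smult_assoc_mat[of _ n n _ n] mult_carrier_mat[of _ n n _ n] smult_carrier_mat
        del: index_mult_mat(1))
  finally show "(mat_exp X * M) $$ (p, q) = ((M + N + (1/2) \<cdot>\<^sub>m N') * mat_exp X) $$ (p, q)" .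
qed

section \<open>Derivatives of matrix exponentials and of scalar products\<close>

lemma pow_mat_has_derivative:
  fixes X Y :: "complex mat"
  assumes X: "X \<in> carrier_mat n n" and Y: "Y \<in> carrier_mat n n" and XY: "X * Y = Y * X"
    and p: "p < n"
  shows "q < n \<Longrightarrow> ((\<lambda>s. ((s \<cdot>\<^sub>m X + Y) ^\<^sub>m k) $$ (p, q)) has_field_derivative
    of_nat k * (X * (t \<cdot>\<^sub>m X + Y) ^\<^sub>m (k - 1)) $$ (p, q)) (at t)"
proof (induction k arbitrary: q)
  case 0
  then show ?case using X Y p by simp
next
  case (Suc k)
  define Z where "Z s = s \<cdot>\<^sub>m X + Y" for s
  have Z: "Z s \<in> carrier_mat n n" for s
    using X Y by (simp add: Z_def)
  have P: "Z s ^\<^sub>m k \<in> carrier_mat n n" for s k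
    using Z by simp
  have XP: "X * Z s ^\<^sub>m k \<in> carrier_mat n n" for s k
    using X P by (rule mult_carrier_mat)
  have ent: "Z s $$ (r, q) = s * X $$ (r, q) + Y $$ (r, q)" if "r < n" for s r
    using X Y that Suc.prems by (simp add: Z_def)
  have ZX: "Z t * X = X * Z t"
    unfolding Z_def using X Y XY
    by (simp add: add_mult_distrib_mat[where nr = n and n = n and nc = n]
        mult_add_distrib_mat[of _ n n _ n _] mult_smult_distrib[of _ n n _ n]
        mult_smult_assoc_mat[of _ n n _ n] smult_carrier_mat)
  have "((\<lambda>s. \<Sum>r<n. (Z s ^\<^sub>m k) $$ (p, r) * (s * X $$ (r, q) + Y $$ (r, q))) has_field_derivative
      (\<Sum>r<n. of_nat k * (X * Z t ^\<^sub>m (k - 1)) $$ (p, r) * Z t $$ (r, q) +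
        (Z t ^\<^sub>m k) $$ (p, r) * X $$ (r, q))) (at t)"
    using Suc.IH[folded Z_def]
    by (intro DERIV_sum) (auto intro!: derivative_eq_intros simp: ent)
  also have "(\<Sum>r<n. of_nat k * (X * Z t ^\<^sub>m (k - 1)) $$ (p, r) * Z t $$ (r, q) +
        (Z t ^\<^sub>m k) $$ (p, r) * X $$ (r, q)) =
      of_nat k * (X * Z t ^\<^sub>m (k - 1) * Z t) $$ (p, q) + (Z t ^\<^sub>m k * X) $$ (p, q)"
    unfolding mult_mat_entry[OF XP Z p Suc.prems] mult_mat_entry[OF P X p Suc.prems]
    by (simp add: sum.distrib sum_distrib_left mult.assoc del: index_mult_mat(1))
  \<comment> \<open>For \<open>k = 0\<close> the truncated \<open>k - 1\<close> gives the wrong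
    power, but the factor \<open>of_nat k\<close> is zero on both sides.\<close>
  also have "of_nat k * (X * Z t ^\<^sub>m (k - 1) * Z t) $$ (p, q) = of_nat k * (X * Z t ^\<^sub>m k) $$ (p, q)"
    using X Z P by (cases k) (simp_all add: assoc_mult_mat[of _ n n _ n _ n] del: index_mult_mat(1))
  \<comment> \<open>Because \<open>X\<close> commutes with the whole curve, the last term of the
    product rule agrees with the others and only raises the multiplicity.\<close>
  also have "Z t ^\<^sub>m k * X = X * Z t ^\<^sub>m k"
    by (rule pow_mat_commute[OF Z X ZX])
  also have "of_nat k * (X * Z t ^\<^sub>m k) $$ (p, q) + (X * Z t ^\<^sub>m k) $$ (p, q) =
      of_nat (Suc k) * (X * Z t ^\<^sub>m k) $$ (p, q)"
    by (simp add: algebra_simps del: index_mult_mat(1))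
  also have "(\<lambda>s. \<Sum>r<n. (Z s ^\<^sub>m k) $$ (p, r) * (s * X $$ (r, q) + Y $$ (r, q))) =
      (\<lambda>s. (Z s ^\<^sub>m Suc k) $$ (p, q))"
    by (simp add: mult_mat_entry[OF P Z p Suc.prems] ent del: index_mult_mat(1))
  finally show ?case
    by (simp add: Z_def del: index_mult_mat(1))
qed

text \<open>The dimension is a parameter and not part of the matrix type, so differentiability of a
  curve is stated through its scalar entries.\<close>

definition entrywise_deriv :: "nat \<Rightarrow> (complex \<Rightarrow> complex mat) \<Rightarrow> complex mat \<Rightarrow> complex \<Rightarrow> bool" where
  "entrywise_deriv n A A' t \<longleftrightarrow>
     (\<forall>p<n. \<forall>q<n. ((\<lambda>s. A s $$ (p, q)) has_field_derivative A' $$ (p, q)) (at t))"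

text \<open>The bound \<open>K\<close> is uniform in \<open>s\<close>; the exponential is thus the
  same finite sum along the whole curve, and termwise differentiation requires no limit
  interchange.\<close>

lemma entrywise_deriv_mat_exp:
  fixes X Y :: "complex mat"
  assumes X: "X \<in> carrier_mat n n" and Y: "Y \<in> carrier_mat n n" and XY: "X * Y = Y * X"
    and nil: "\<And>s k. k \<ge> K \<Longrightarrow> (s \<cdot>\<^sub>m X + Y) ^\<^sub>m k = 0\<^sub>m n n"
  shows "entrywise_deriv n (\<lambda>s. mat_exp (s \<cdot>\<^sub>m X + Y)) (X * mat_exp (t \<cdot>\<^sub>m X + Y)) t"
  unfolding entrywise_deriv_def
proof (intro allI impI)
  fix p q assume pq: "p < n" "q < n"
  have Z: "s \<cdot>\<^sub>m X + Y \<in> carrier_mat n n" for s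
    using X Y by simp
  \<comment> \<open>Differentiation kills the constant term and shifts the index by one, so summing
    to \<open>Suc K\<close> leaves exactly \<open>K\<close> terms of the series on the
    right.\<close>
  have "(\<lambda>s. mat_exp (s \<cdot>\<^sub>m X + Y) $$ (p, q)) =
      (\<lambda>s. \<Sum>k<Suc K. ((s \<cdot>\<^sub>m X + Y) ^\<^sub>m k) $$ (p, q) / fact k)"
    by (intro ext mat_exp_nilpotent_entry[OF Z _ pq]) (simp add: nil)
  moreover have "((\<lambda>s. \<Sum>k<Suc K. ((s \<cdot>\<^sub>m X + Y) ^\<^sub>m k) $$ (p, q) / fact k) has_field_derivative
      (\<Sum>k<Suc K. of_nat k * (X * (t \<cdot>\<^sub>m X + Y) ^\<^sub>m (k - 1)) $$ (p, q) / fact k)) (at t)"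
    by (intro DERIV_sum DERIV_cdivide pow_mat_has_derivative[OF X Y XY pq])
  moreover have "(\<Sum>k<Suc K. of_nat k * (X * (t \<cdot>\<^sub>m X + Y) ^\<^sub>m (k - 1)) $$ (p, q) / fact k) =
      (X * mat_exp (t \<cdot>\<^sub>m X + Y)) $$ (p, q)"
  proof -
    have "of_nat (Suc k) * (X * (t \<cdot>\<^sub>m X + Y) ^\<^sub>m (Suc k - 1)) $$ (p, q) / fact (Suc k) =
        (X * (t \<cdot>\<^sub>m X + Y) ^\<^sub>m k) $$ (p, q) / fact k" for k
      using of_nat_neq_0[of k, where 'a = complex]
      by (simp add: fact_Suc del: of_nat_Suc index_mult_mat(1))
    moreover have "(X * mat_exp (t \<cdot>\<^sub>m X + Y)) $$ (p, q) =
        (\<Sum>k<K. (X * (t \<cdot>\<^sub>m X + Y) ^\<^sub>m k) $$ (p, q) / fact k)"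
      by (rule mat_exp_mult_entry(2)[OF Z X nil pq])
    ultimately show ?thesis
      by (simp only: sum.lessThan_Suc_shift) simp
  qed
  ultimately show "((\<lambda>s. mat_exp (s \<cdot>\<^sub>m X + Y) $$ (p, q)) has_field_derivative
      (X * mat_exp (t \<cdot>\<^sub>m X + Y)) $$ (p, q)) (at t)"
    by simp
qed

lemma entrywise_deriv_mult_left:
  assumes "entrywise_deriv n A A' t" and B: "B \<in> carrier_mat n n"
    and A: "\<And>s. A s \<in> carrier_mat n n" and A': "A' \<in> carrier_mat n n"
  shows "entrywise_deriv n (\<lambda>s. B * A s) (B * A') t"
  using assms(1) unfolding entrywise_deriv_def
  by (auto simp: mult_mat_entry[OF B A] mult_mat_entry[OF B A'] mult.commute simp del: index_mult_mat(1)
      intro!: derivative_eq_intros)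

lemma entrywise_deriv_mult_right:
  assumes "entrywise_deriv n A A' t" and B: "B \<in> carrier_mat n n"
    and A: "\<And>s. A s \<in> carrier_mat n n" and A': "A' \<in> carrier_mat n n"
  shows "entrywise_deriv n (\<lambda>s. A s * B) (A' * B) t"
  using assms(1) unfolding entrywise_deriv_def
  by (auto simp: mult_mat_entry[OF A B] mult_mat_entry[OF A' B] simp del: index_mult_mat(1)
      intro!: derivative_eq_intros)

lemma inner_prod_mult_mat_vec:
  assumes "A \<in> carrier_mat n n" "u \<in> carrier_vec n" "v \<in> carrier_vec n"
  shows "inner_prod u (A *\<^sub>v v) = (\<Sum>p<n. \<Sum>q<n. A $$ (p, q) * v $ q * cnj (u $ p))"
  using assms
  by (auto simp: inner_prod_def scalar_prod_def atLeast0LessThan sum_distrib_right intro!: sum.cong)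

lemma entrywise_deriv_inner_prod:
  assumes d: "entrywise_deriv n A A' t"
    and A: "\<And>s. A s \<in> carrier_mat n n" and A': "A' \<in> carrier_mat n n"
    and u: "u \<in> carrier_vec n" and v: "v \<in> carrier_vec n"
  shows "((\<lambda>s. inner_prod u (A s *\<^sub>v v)) has_field_derivative inner_prod u (A' *\<^sub>v v)) (at t)"
  unfolding inner_prod_mult_mat_vec[OF A u v] inner_prod_mult_mat_vec[OF A' u v]
  using d unfolding entrywise_deriv_def
  by (intro DERIV_sum DERIV_cmult_right) auto

lemma inner_prod_adjoint:
  assumes A: "A \<in> carrier_mat n n" and u: "u \<in> carrier_vec n" and v: "v \<in> carrier_vec n"
  shows "inner_prod (mat_adjoint A *\<^sub>v u) v = inner_prod u (A *\<^sub>v v)"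
proof -
  have "inner_prod (mat_adjoint A *\<^sub>v u) v = (\<Sum>q<n. \<Sum>p<n. A $$ (p, q) * v $ q * cnj (u $ p))"
    using A u v
    by (auto simp: inner_prod_def scalar_prod_def atLeast0LessThan sum_distrib_left mat_adjoint_def
        mat_of_rows_def intro!: sum.cong)
  also have "\<dots> = inner_prod u (A *\<^sub>v v)"
    unfolding inner_prod_mult_mat_vec[OF A u v] by (rule sum.swap)
  finally show ?thesis .
qed

section \<open>Linear combinations of the generators\<close>

lemma atLeastAtMost_1_3: "{Suc 0..3} = {Suc 0, 2, 3}"
  by auto

lemma sum_swap_pairs:
  fixes A B S T :: "'b set"
  shows "(\<Sum>k\<in>A. \<Sum>l\<in>B. \<Sum>i\<in>S. \<Sum>j\<in>T. f i j k l) =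
    (\<Sum>i\<in>S. \<Sum>j\<in>T. \<Sum>k\<in>A. \<Sum>l\<in>B. f i j k l :: 'a :: comm_monoid_add)"
proof -
  have swap: "(\<Sum>k\<in>A. \<Sum>i\<in>S. \<Sum>j\<in>T. g i j k) = (\<Sum>i\<in>S. \<Sum>j\<in>T. \<Sum>k\<in>A. g i j k)"
    for A :: "'b set" and g :: "'b \<Rightarrow> 'b \<Rightarrow> 'b \<Rightarrow> 'a"
    by (subst sum.swap) (intro sum.cong refl sum.swap)
  have "(\<Sum>k\<in>A. \<Sum>l\<in>B. \<Sum>i\<in>S. \<Sum>j\<in>T. f i j k l) =
      (\<Sum>k\<in>A. \<Sum>i\<in>S. \<Sum>j\<in>T. \<Sum>l\<in>B. f i j k l)"
    by (intro sum.cong refl swap)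
  then show ?thesis
    by (rule trans) (rule swap)
qed

text \<open>The linear extension of the representation from matrix units to all 3x3 matrices
  \<open>m\<close>. Coefficients are functions of indices, which reduces identities in gl(3) to sums
  over three values.\<close>

definition lin_rep :: "nat \<Rightarrow> generators \<Rightarrow> (nat \<Rightarrow> nat \<Rightarrow> complex) \<Rightarrow> complex mat" where
  "lin_rep n C m = mat n n (\<lambda>(p, q). \<Sum>i\<in>{1..3}. \<Sum>j\<in>{1..3}. m i j * C i j $$ (p, q))"

definition comm3 :: "(nat \<Rightarrow> nat \<Rightarrow> complex) \<Rightarrow> (nat \<Rightarrow> nat \<Rightarrow> complex) \<Rightarrow> nat \<Rightarrow> nat \<Rightarrow> complex" where
  "comm3 a b i j = (\<Sum>k\<in>{1..3}. a i k * b k j - b i k * a k j)"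

definition unit3 :: "nat \<Rightarrow> nat \<Rightarrow> nat \<Rightarrow> nat \<Rightarrow> complex" where
  "unit3 i j k l = (if k = i \<and> l = j then 1 else 0)"

lemma lin_rep_carrier: "lin_rep n C m \<in> carrier_mat n n"
  by (simp add: lin_rep_def)

lemma lin_rep_cong:
  "(\<And>i j. i \<in> {1..3} \<Longrightarrow> j \<in> {1..3} \<Longrightarrow> a i j = b i j) \<Longrightarrow> lin_rep n C a = lin_rep n C b"
  by (auto simp: lin_rep_def intro!: cong_mat sum.cong)

lemma lin_rep_add: "lin_rep n C (\<lambda>i j. a i j + b i j) = lin_rep n C a + lin_rep n C b"
  by (rule eq_matI) (simp_all add: lin_rep_def algebra_simps sum.distrib)

lemma lin_rep_smult: "lin_rep n C (\<lambda>i j. c * a i j) = c \<cdot>\<^sub>m lin_rep n C a"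
  by (rule eq_matI) (simp_all add: lin_rep_def sum_distrib_left mult.assoc)

lemma lin_rep_zero: "lin_rep n C (\<lambda>i j. 0) = 0\<^sub>m n n"
  by (rule eq_matI) (simp_all add: lin_rep_def)

lemma lin_rep_unit:
  assumes "gl3_rep n C" "i \<in> {1..3}" "j \<in> {1..3}"
  shows "lin_rep n C (unit3 i j) = C i j"
proof (rule eq_matI)
  have car: "C i j \<in> carrier_mat n n"
    using assms by (auto simp: gl3_rep_def)
  show "dim_row (lin_rep n C (unit3 i j)) = dim_row (C i j)"
    "dim_col (lin_rep n C (unit3 i j)) = dim_col (C i j)"
    using car by (simp_all add: lin_rep_def)
  fix p q assume "p < dim_row (C i j)" "q < dim_col (C i j)"
  then show "lin_rep n C (unit3 i j) $$ (p, q) = C i j $$ (p, q)"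
    using car assms(2,3) by (auto simp: lin_rep_def unit3_def atLeastAtMost_1_3)
qed

lemma lin_rep_mult_entry:
  assumes C: "gl3_rep n C" and pq: "p < n" "q < n"
  shows "(lin_rep n C a * lin_rep n C b) $$ (p, q) =
    (\<Sum>i\<in>{1..3}. \<Sum>j\<in>{1..3}. \<Sum>k\<in>{1..3}. \<Sum>l\<in>{1..3}. a i j * b k l * (C i j * C k l) $$ (p, q))"
proof -
  let ?I = "{1..3} :: nat set"
  have car: "C i j \<in> carrier_mat n n" if "i \<in> ?I" "j \<in> ?I" for i j
    using C that by (auto simp: gl3_rep_def)
  have "(lin_rep n C a * lin_rep n C b) $$ (p, q) =
      (\<Sum>r<n. (\<Sum>i\<in>?I. \<Sum>j\<in>?I. a i j * C i j $$ (p, r)) * (\<Sum>k\<in>?I. \<Sum>l\<in>?I. b k l * C k l $$ (r, q)))"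
    unfolding mult_mat_entry[OF lin_rep_carrier lin_rep_carrier pq]
    using pq by (intro sum.cong) (auto simp: lin_rep_def)
  also have "\<dots> = (\<Sum>r<n. \<Sum>i\<in>?I. \<Sum>j\<in>?I. \<Sum>k\<in>?I. \<Sum>l\<in>?I.
      a i j * b k l * (C i j $$ (p, r) * C k l $$ (r, q)))"
    by (simp only: sum_distrib_right, simp only: sum_distrib_left, simp only: mult_ac)
  also have "\<dots> = (\<Sum>i\<in>?I. \<Sum>j\<in>?I. \<Sum>k\<in>?I. \<Sum>l\<in>?I.
      a i j * b k l * (\<Sum>r<n. C i j $$ (p, r) * C k l $$ (r, q)))"
    by (simp only: sum_distrib_left sum.swap[of _ _ "{..<n}"])
  also have "\<dots> = (\<Sum>i\<in>?I. \<Sum>j\<in>?I. \<Sum>k\<in>?I. \<Sum>l\<in>?I. a i j * b k l * (C i j * C k l) $$ (p, q))"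
    by (intro sum.cong refl) (simp only: mult_mat_entry[OF car car pq])
  finally show ?thesis .
qed

text \<open>By bilinearity the relations between generators make the linear extension a Lie algebra
  homomorphism. From here on commutators of operators of any size are computed on 3x3
  coefficients.\<close>

lemma lin_rep_commute:
  assumes C: "gl3_rep n C"
  shows "lin_rep n C a * lin_rep n C b = lin_rep n C b * lin_rep n C a + lin_rep n C (comm3 a b)"
proof (rule eq_matI)
  let ?I = "{1..3} :: nat set"
  have car: "C i j \<in> carrier_mat n n" if "i \<in> ?I" "j \<in> ?I" for i j
    using C that by (auto simp: gl3_rep_def)
  show "dim_row (lin_rep n C a * lin_rep n C b) =
      dim_row (lin_rep n C b * lin_rep n C a + lin_rep n C (comm3 a b))"
    "dim_col (lin_rep n C a * lin_rep n C b) =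
      dim_col (lin_rep n C b * lin_rep n C a + lin_rep n C (comm3 a b))"
    by (simp_all add: lin_rep_def)
  fix p q
  assume "p < dim_row (lin_rep n C b * lin_rep n C a + lin_rep n C (comm3 a b))"
    "q < dim_col (lin_rep n C b * lin_rep n C a + lin_rep n C (comm3 a b))"
  then have pq: "p < n" "q < n"
    by (simp_all add: lin_rep_def)
  define c where "c i j = C i j $$ (p, q)" for i j
  have rel: "(C i j * C k l) $$ (p, q) - (C k l * C i j) $$ (p, q) =
      (if j = k then c i l else 0) - (if i = l then c k j else 0)"
    if "i \<in> ?I" "j \<in> ?I" "k \<in> ?I" "l \<in> ?I" for i j k l
  proof -
    have "C i j * C k l - C k l * C i j =
        (if j = k then C i l else 0\<^sub>m n n) - (if i = l then C k j else 0\<^sub>m n n)"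
      using C that by (auto simp: gl3_rep_def)
    from arg_cong[OF this, of "\<lambda>M. M $$ (p, q)"] show ?thesis
      using pq car[OF that(1,2)] car[OF that(3,4)] car[OF that(1,4)] car[OF that(3,2)]
      by (simp add: c_def del: index_mult_mat(1))
  qed
  have "(lin_rep n C b * lin_rep n C a) $$ (p, q) =
      (\<Sum>k\<in>?I. \<Sum>l\<in>?I. \<Sum>i\<in>?I. \<Sum>j\<in>?I. b k l * a i j * (C k l * C i j) $$ (p, q))"
    by (rule lin_rep_mult_entry[OF C pq])
  \<comment> \<open>The two index pairs are interchanged so that both products run over the same
    quadruples and can be subtracted term by term.\<close>
  also have "\<dots> = (\<Sum>i\<in>?I. \<Sum>j\<in>?I. \<Sum>k\<in>?I. \<Sum>l\<in>?I. a i j * b k l * (C k l * C i j) $$ (p, q))"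
    by (subst sum_swap_pairs) (simp only: mult.commute)
  finally have "(lin_rep n C a * lin_rep n C b) $$ (p, q) - (lin_rep n C b * lin_rep n C a) $$ (p, q) =
      (\<Sum>i\<in>?I. \<Sum>j\<in>?I. \<Sum>k\<in>?I. \<Sum>l\<in>?I.
        a i j * b k l * ((C i j * C k l) $$ (p, q) - (C k l * C i j) $$ (p, q)))"
    by (simp only: lin_rep_mult_entry[OF C pq] sum_subtractf right_diff_distrib)
  also have "\<dots> = (\<Sum>i\<in>?I. \<Sum>j\<in>?I. \<Sum>k\<in>?I. \<Sum>l\<in>?I.
        a i j * b k l * ((if j = k then c i l else 0) - (if i = l then c k j else 0)))"
    by (intro sum.cong refl) (simp only: rel)
  also have "\<dots> = (\<Sum>i\<in>?I. \<Sum>j\<in>?I. comm3 a b i j * c i j)"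
    by (simp add: atLeastAtMost_1_3 comm3_def algebra_simps)
  also have "\<dots> = lin_rep n C (comm3 a b) $$ (p, q)"
    using pq by (simp add: lin_rep_def c_def)
  finally show "(lin_rep n C a * lin_rep n C b) $$ (p, q) =
      (lin_rep n C b * lin_rep n C a + lin_rep n C (comm3 a b)) $$ (p, q)"
    using pq carrier_matD[OF lin_rep_carrier[of n C]] by (simp add: algebra_simps del: index_mult_mat(1))
qed

text \<open>Transfers the conjugation formula to coefficients: apart from nilpotency of the
  operator, only identities between 3x3 arrays remain to be checked.\<close>

lemma mat_exp_lin_rep_conjugate:
  assumes C: "gl3_rep n C"
    and nil: "\<And>k. k \<ge> K \<Longrightarrow> lin_rep n C x ^\<^sub>m k = 0\<^sub>m n n"
    and x: "\<And>i j. i \<in> {1..3} \<Longrightarrow> j \<in> {1..3} \<Longrightarrow> comm3 x (comm3 x (comm3 x m)) i j = 0"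
    and m': "\<And>i j. i \<in> {1..3} \<Longrightarrow> j \<in> {1..3} \<Longrightarrow>
      m' i j = m i j + comm3 x m i j + 1/2 * comm3 x (comm3 x m) i j"
  shows "mat_exp (lin_rep n C x) * lin_rep n C m = lin_rep n C m' * mat_exp (lin_rep n C x)"
proof -
  let ?L = "lin_rep n C"
  have "?L (comm3 x (comm3 x (comm3 x m))) = 0\<^sub>m n n"
    using lin_rep_cong[where n = n and C = C, OF x] lin_rep_zero by simp
  then have "?L x * ?L (comm3 x (comm3 x m)) = ?L (comm3 x (comm3 x m)) * ?L x"
    using lin_rep_commute[OF C, of x "comm3 x (comm3 x m)"]
    by (simp add: mult_carrier_mat[OF lin_rep_carrier lin_rep_carrier])
  then have "mat_exp (?L x) * ?L m =
      (?L m + ?L (comm3 x m) + (1/2) \<cdot>\<^sub>m ?L (comm3 x (comm3 x m))) * mat_exp (?L x)"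
    by (intro mat_exp_conjugate[where n = n and K = K] lin_rep_carrier lin_rep_commute[OF C] nil)
  also have "?L m + ?L (comm3 x m) + (1/2) \<cdot>\<^sub>m ?L (comm3 x (comm3 x m)) = ?L m'"
    unfolding lin_rep_add[symmetric] lin_rep_smult[symmetric] by (rule lin_rep_cong) (simp add: m')
  finally show ?thesis .
qed

text \<open>\<open>unipotent z\<close> holds the entries of \<open>V'\<^sub>+(z)\<close>, and \<open>unipotent_inv z\<close> those of its inverse.\<close>

definition unipotent :: "point \<Rightarrow> nat \<Rightarrow> nat \<Rightarrow> complex" where
  "unipotent z i j = (if i = j then 1 else if i = 1 \<and> j = 2 then z Z12 else if i = 1 \<and> j = 3 then z Z13
     else if i = 2 \<and> j = 3 then z Z23 else 0)"

definition unipotent_inv :: "point \<Rightarrow> nat \<Rightarrow> nat \<Rightarrow> complex" where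
  "unipotent_inv z i j = (if i = j then 1 else if i = 1 \<and> j = 2 then - z Z12
     else if i = 1 \<and> j = 3 then z Z12 * z Z23 - z Z13 else if i = 2 \<and> j = 3 then - z Z23 else 0)"

text \<open>This and \<open>raising1\<close> are the exponents of the two factors of V'. Each
  squares to zero as a 3x3 matrix, which makes triple commutators with it vanish.\<close>

definition raising23 :: "complex \<Rightarrow> nat \<Rightarrow> nat \<Rightarrow> complex" where
  "raising23 a i j = (if i = 2 \<and> j = 3 then a else 0)"

definition raising1 :: "complex \<Rightarrow> complex \<Rightarrow> nat \<Rightarrow> nat \<Rightarrow> complex" where
  "raising1 a b i j = (if i = 1 \<and> j = 2 then a else if i = 1 \<and> j = 3 then b else 0)"

lemma lin_rep_raising23:
  assumes "gl3_rep n C"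
  shows "lin_rep n C (raising23 a) = a \<cdot>\<^sub>m C 2 3"
proof -
  have "lin_rep n C (raising23 a) = lin_rep n C (\<lambda>i j. a * unit3 2 3 i j)"
    by (rule lin_rep_cong) (simp add: raising23_def unit3_def)
  then show ?thesis
    by (simp add: lin_rep_smult lin_rep_unit[OF assms])
qed

lemma lin_rep_raising1:
  assumes "gl3_rep n C"
  shows "lin_rep n C (raising1 a b) = a \<cdot>\<^sub>m C 1 2 + b \<cdot>\<^sub>m C 1 3"
proof -
  have "lin_rep n C (raising1 a b) = lin_rep n C (\<lambda>i j. a * unit3 1 2 i j + b * unit3 1 3 i j)"
    by (rule lin_rep_cong) (simp add: raising1_def unit3_def)
  then show ?thesis
    by (simp add: lin_rep_add lin_rep_smult lin_rep_unit[OF assms])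
qed

text \<open>Commutation with E_22 fixes every multiple of E_23, and commutation with E_11 fixes
  every combination of E_12 and E_13. The bound from \<open>ad_eigenvector_nilpotent\<close> depends
  on the diagonal generator only, hence one \<open>K\<close> works for all \<open>a\<close> and
  \<open>b\<close>.\<close>

lemma raising_nilpotent:
  assumes C: "gl3_rep n C"
  obtains K where "\<And>a k. k \<ge> K \<Longrightarrow> lin_rep n C (raising23 a) ^\<^sub>m k = 0\<^sub>m n n"
    "\<And>a b k. k \<ge> K \<Longrightarrow> lin_rep n C (raising1 a b) ^\<^sub>m k = 0\<^sub>m n n"
proof -
  let ?L = "lin_rep n C"
  have eigen: "?L h * ?L x = ?L x + ?L x * ?L h"
    if "\<And>i j. i \<in> {1..3} \<Longrightarrow> j \<in> {1..3} \<Longrightarrow> comm3 h x i j = x i j" for h x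
    using lin_rep_commute[OF C, of h x] lin_rep_cong[where n = n and C = C, OF that]
      comm_add_mat[OF mult_carrier_mat[OF lin_rep_carrier[of n C x] lin_rep_carrier[of n C h]] lin_rep_carrier]
    by simp
  obtain K where K: "\<And>X k. X \<in> carrier_mat n n \<Longrightarrow> ?L (unit3 2 2) * X = X + X * ?L (unit3 2 2) \<Longrightarrow>
      k \<ge> K \<Longrightarrow> X ^\<^sub>m k = 0\<^sub>m n n"
    using ad_eigenvector_nilpotent[OF lin_rep_carrier] by metis
  obtain K' where K': "\<And>X k. X \<in> carrier_mat n n \<Longrightarrow> ?L (unit3 1 1) * X = X + X * ?L (unit3 1 1) \<Longrightarrow>
      k \<ge> K' \<Longrightarrow> X ^\<^sub>m k = 0\<^sub>m n n"
    using ad_eigenvector_nilpotent[OF lin_rep_carrier] by metis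
  show ?thesis
  proof
    fix k :: nat and a b assume k: "max K K' \<le> k"
    show "?L (raising23 a) ^\<^sub>m k = 0\<^sub>m n n"
      using k by (intro K lin_rep_carrier eigen)
        (auto simp: comm3_def raising23_def unit3_def atLeastAtMost_1_3)
    show "?L (raising1 a b) ^\<^sub>m k = 0\<^sub>m n n"
      using k by (intro K' lin_rep_carrier eigen)
        (auto simp: comm3_def raising1_def unit3_def atLeastAtMost_1_3)
  qed
qed

section \<open>The operator of V' and its adjoint action\<close>

lemma V_plus_lin_rep:
  assumes "gl3_rep n C"
  shows "V_plus C z = mat_exp (lin_rep n C (raising23 (z Z23))) * mat_exp (lin_rep n C (raising1 (z Z12) (z Z13)))"
  by (simp add: V_plus_def lin_rep_raising23[OF assms] lin_rep_raising1[OF assms])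

lemma V_plus_carrier: "gl3_rep n C \<Longrightarrow> V_plus C z \<in> carrier_mat n n"
  by (simp add: V_plus_lin_rep mult_carrier_mat[of _ n n _ n] mat_exp_carrier lin_rep_carrier)

text \<open>Since x squares to zero, half the double commutator of x with m is -x m x, and the
  second-order formula is (1 + x) m (1 - x). Applying it for the right factor and then the left one
  assembles V' m V'^(-1).\<close>

lemma V_plus_conjugate:
  assumes C: "gl3_rep n C"
  shows "V_plus C z * lin_rep n C m =
    lin_rep n C (\<lambda>k l. \<Sum>i\<in>{1..3}. \<Sum>j\<in>{1..3}. unipotent z k i * m i j * unipotent_inv z j l) * V_plus C z"
proof -
  let ?L = "lin_rep n C"
  let ?x = "raising1 (z Z12) (z Z13)" and ?y = "raising23 (z Z23)"
  let ?m' = "\<lambda>i j. m i j + comm3 ?x m i j + 1/2 * comm3 ?x (comm3 ?x m) i j"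
  let ?m'' = "\<lambda>k l. \<Sum>i\<in>{1..3}. \<Sum>j\<in>{1..3}. unipotent z k i * m i j * unipotent_inv z j l"
  obtain K where K: "\<And>a k. k \<ge> K \<Longrightarrow> ?L (raising23 a) ^\<^sub>m k = 0\<^sub>m n n"
    "\<And>a b k. k \<ge> K \<Longrightarrow> ?L (raising1 a b) ^\<^sub>m k = 0\<^sub>m n n"
    using raising_nilpotent[OF C] by blast
  have E: "mat_exp (?L x) \<in> carrier_mat n n" for x
    by (simp add: mat_exp_carrier lin_rep_carrier)
  note assoc = assoc_mult_mat[of _ n n _ n _ n]
  have "V_plus C z * ?L m = mat_exp (?L ?y) * (mat_exp (?L ?x) * ?L m)"
    by (simp add: V_plus_lin_rep[OF C] assoc E lin_rep_carrier)
  also have "mat_exp (?L ?x) * ?L m = ?L ?m' * mat_exp (?L ?x)"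
    by (rule mat_exp_lin_rep_conjugate[OF C K(2)])
      (auto simp: comm3_def raising1_def atLeastAtMost_1_3)
  also have "mat_exp (?L ?y) * (?L ?m' * mat_exp (?L ?x)) = (mat_exp (?L ?y) * ?L ?m') * mat_exp (?L ?x)"
    by (simp add: assoc E lin_rep_carrier)
  also have "mat_exp (?L ?y) * ?L ?m' = ?L ?m'' * mat_exp (?L ?y)"
    by (rule mat_exp_lin_rep_conjugate[OF C K(1)])
      (auto simp: comm3_def raising1_def raising23_def unipotent_def unipotent_inv_def atLeastAtMost_1_3
        algebra_simps)
  also have "?L ?m'' * mat_exp (?L ?y) * mat_exp (?L ?x) = ?L ?m'' * V_plus C z"
    by (simp add: V_plus_lin_rep[OF C] assoc E lin_rep_carrier)
  finally show ?thesis .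
qed

section \<open>The differential operators\<close>

text \<open>\<open>unipotent z k i * unipotent_inv z j l\<close> is the (k,l) entry of V' E_ij
  V'^(-1). The extra term for \<open>Z13\<close> arises because the generator \<open>C 1 2\<close>
  acts as the z12 derivative plus z23 times the z13 derivative.\<close>

definition first_order_coeff :: "nat \<Rightarrow> nat \<Rightarrow> coord \<Rightarrow> point \<Rightarrow> complex" where
  "first_order_coeff i j \<alpha> z = (case \<alpha> of
     Z12 \<Rightarrow> unipotent z 1 i * unipotent_inv z j 2
   | Z13 \<Rightarrow> unipotent z 1 i * (unipotent_inv z j 3 + z Z23 * unipotent_inv z j 2)
   | Z23 \<Rightarrow> unipotent z 2 i * unipotent_inv z j 3)"

definition zeroth_order_coeff :: "(nat \<Rightarrow> real) \<Rightarrow> nat \<Rightarrow> nat \<Rightarrow> point \<Rightarrow> complex" where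
  "zeroth_order_coeff w i j z =
     (\<Sum>k\<in>{1..3}. complex_of_real (w k) * (unipotent z k i * unipotent_inv z j k))"

lemma polynomial_fun_if:
  "polynomial_fun f \<Longrightarrow> polynomial_fun g \<Longrightarrow> polynomial_fun (\<lambda>z. if c then f z else g z)"
  by (cases c) simp_all

lemma polynomial_fun_unipotent: "polynomial_fun (\<lambda>z. unipotent z i j)"
  unfolding unipotent_def
  by (intro polynomial_fun_if polynomial_fun_const polynomial_fun_coord)

lemma polynomial_fun_unipotent_inv: "polynomial_fun (\<lambda>z. unipotent_inv z i j)"
  unfolding unipotent_inv_def
  by (intro polynomial_fun_if polynomial_fun_const polynomial_fun_coord polynomial_fun_uminus
      polynomial_fun_diff polynomial_fun_mult)

lemma polynomial_fun_first_order_coeff: "polynomial_fun (first_order_coeff i j \<alpha>)"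
proof -
  have "polynomial_fun (\<lambda>z. first_order_coeff i j \<alpha> z)"
    unfolding first_order_coeff_def
    by (cases \<alpha>) (simp_all add: polynomial_fun_unipotent polynomial_fun_unipotent_inv
        polynomial_fun_add polynomial_fun_mult polynomial_fun_coord)
  then show ?thesis .
qed

lemma polynomial_fun_zeroth_order_coeff: "polynomial_fun (zeroth_order_coeff w i j)"
proof -
  have "polynomial_fun (\<lambda>z. zeroth_order_coeff w i j z)"
    unfolding zeroth_order_coeff_def
    by (intro polynomial_fun_sum polynomial_fun_mult polynomial_fun_const
        polynomial_fun_unipotent polynomial_fun_unipotent_inv)
  then show ?thesis .
qed

section \<open>Derivatives along the coordinates\<close>

lemma lin_rep_curve_deriv:
  assumes C: "gl3_rep n C"
    and nil: "\<And>s k. k \<ge> K \<Longrightarrow> lin_rep n C (m s) ^\<^sub>m k = 0\<^sub>m n n"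
    and m: "\<And>s i j. m s i j = s * x i j + y i j"
    and xy: "\<And>i j. i \<in> {1..3} \<Longrightarrow> j \<in> {1..3} \<Longrightarrow> comm3 x y i j = 0"
  shows "entrywise_deriv n (\<lambda>s. mat_exp (lin_rep n C (m s)))
    (lin_rep n C x * mat_exp (lin_rep n C (m t))) t"
proof -
  let ?L = "lin_rep n C"
  have curve: "?L (m s) = s \<cdot>\<^sub>m ?L x + ?L y" for s
    unfolding lin_rep_smult[symmetric] lin_rep_add[symmetric]
    by (rule lin_rep_cong) (rule m)
  have "?L (comm3 x y) = 0\<^sub>m n n"
    using lin_rep_cong[where n = n and C = C, OF xy] lin_rep_zero by simp
  then have "?L x * ?L y = ?L y * ?L x"
    using lin_rep_commute[OF C, of x y] by (simp add: mult_carrier_mat[OF lin_rep_carrier lin_rep_carrier])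
  then show ?thesis
    using nil unfolding curve
    by (intro entrywise_deriv_mat_exp[where K = K] lin_rep_carrier)
qed

text \<open>Differentiating an exponential brings down its generator. For z23 this already stands
  leftmost. For z13 and z12 it stands between the factors and must be conjugated by the left one:
  \<open>C 1 3\<close> commutes with \<open>C 2 3\<close>, whereas \<open>C 1 2\<close> acquires the
  commutator -z23 \<open>C 1 3\<close>.\<close>

lemma V_plus_deriv:
  assumes C: "gl3_rep n C"
  shows "entrywise_deriv n (\<lambda>s. V_plus C (z(Z23 := s))) (lin_rep n C (raising23 1) * V_plus C z) (z Z23)"
    and "entrywise_deriv n (\<lambda>s. V_plus C (z(Z13 := s))) (lin_rep n C (raising1 0 1) * V_plus C z) (z Z13)"
    and "entrywise_deriv n (\<lambda>s. V_plus C (z(Z12 := s))) (lin_rep n C (raising1 1 (- z Z23)) * V_plus C z) (z Z12)"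
proof -
  let ?L = "lin_rep n C"
  let ?x = "raising1 (z Z12) (z Z13)" and ?y = "raising23 (z Z23)"
  obtain K where K: "\<And>a k. k \<ge> K \<Longrightarrow> ?L (raising23 a) ^\<^sub>m k = 0\<^sub>m n n"
    "\<And>a b k. k \<ge> K \<Longrightarrow> ?L (raising1 a b) ^\<^sub>m k = 0\<^sub>m n n"
    using raising_nilpotent[OF C] by blast
  have E: "mat_exp (?L x) \<in> carrier_mat n n" for x
    by (simp add: mat_exp_carrier lin_rep_carrier)
  have LE: "?L a * mat_exp (?L x) \<in> carrier_mat n n" for a x
    by (rule mult_carrier_mat[OF lin_rep_carrier E])
  note assoc = assoc_mult_mat[of _ n n _ n _ n]
  have move: "mat_exp (?L ?y) * (?L a * mat_exp (?L ?x)) = ?L b * V_plus C z"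
    if "mat_exp (?L ?y) * ?L a = ?L b * mat_exp (?L ?y)" for a b
  proof -
    have "mat_exp (?L ?y) * (?L a * mat_exp (?L ?x)) = (mat_exp (?L ?y) * ?L a) * mat_exp (?L ?x)"
      by (rule assoc[symmetric, OF E lin_rep_carrier E])
    also have "\<dots> = ?L b * V_plus C z"
      unfolding that V_plus_lin_rep[OF C] by (rule assoc[OF lin_rep_carrier E E])
    finally show ?thesis .
  qed
  have "entrywise_deriv n (\<lambda>s. mat_exp (?L (raising23 s))) (?L (raising23 1) * mat_exp (?L ?y)) (z Z23)"
    by (rule lin_rep_curve_deriv[OF C K(1), where y = "raising23 0"])
      (auto simp: raising23_def comm3_def atLeastAtMost_1_3)
  from entrywise_deriv_mult_right[OF this E E LE]
  show "entrywise_deriv n (\<lambda>s. V_plus C (z(Z23 := s))) (?L (raising23 1) * V_plus C z) (z Z23)"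
    by (simp add: V_plus_lin_rep[OF C] assoc E lin_rep_carrier)
  have "entrywise_deriv n (\<lambda>s. mat_exp (?L (raising1 (z Z12) s))) (?L (raising1 0 1) * mat_exp (?L ?x)) (z Z13)"
    by (rule lin_rep_curve_deriv[OF C K(2), where y = "raising1 (z Z12) 0"])
      (auto simp: raising1_def comm3_def atLeastAtMost_1_3)
  from entrywise_deriv_mult_left[OF this E E LE]
  have "entrywise_deriv n (\<lambda>s. V_plus C (z(Z13 := s)))
      (mat_exp (?L ?y) * (?L (raising1 0 1) * mat_exp (?L ?x))) (z Z13)"
    by (simp add: V_plus_lin_rep[OF C])
  moreover have "mat_exp (?L ?y) * ?L (raising1 0 1) = ?L (raising1 0 1) * mat_exp (?L ?y)"
    by (rule mat_exp_lin_rep_conjugate[OF C K(1)])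
      (auto simp: comm3_def raising1_def raising23_def atLeastAtMost_1_3)
  ultimately show "entrywise_deriv n (\<lambda>s. V_plus C (z(Z13 := s))) (?L (raising1 0 1) * V_plus C z) (z Z13)"
    by (simp add: move)
  have "entrywise_deriv n (\<lambda>s. mat_exp (?L (raising1 s (z Z13)))) (?L (raising1 1 0) * mat_exp (?L ?x)) (z Z12)"
    by (rule lin_rep_curve_deriv[OF C K(2), where y = "raising1 0 (z Z13)"])
      (auto simp: raising1_def comm3_def atLeastAtMost_1_3)
  from entrywise_deriv_mult_left[OF this E E LE]
  have "entrywise_deriv n (\<lambda>s. V_plus C (z(Z12 := s)))
      (mat_exp (?L ?y) * (?L (raising1 1 0) * mat_exp (?L ?x))) (z Z12)"
    by (simp add: V_plus_lin_rep[OF C])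
  moreover have "mat_exp (?L ?y) * ?L (raising1 1 0) = ?L (raising1 1 (- z Z23)) * mat_exp (?L ?y)"
    by (rule mat_exp_lin_rep_conjugate[OF C K(1)])
      (auto simp: comm3_def raising1_def raising23_def atLeastAtMost_1_3)
  ultimately show "entrywise_deriv n (\<lambda>s. V_plus C (z(Z12 := s)))
      (?L (raising1 1 (- z Z23)) * V_plus C z) (z Z12)"
    by (simp add: move)
qed

lemma coherent_fun_eq:
  assumes "gl3_rep n C" "\<phi> \<in> carrier_vec n" "\<psi> \<in> carrier_vec n"
  shows "coherent_fun C \<phi> \<psi> z = inner_prod \<phi> (V_plus C z *\<^sub>v \<psi>)"
  unfolding coherent_fun_def coherent_state_def
  by (rule inner_prod_adjoint[OF V_plus_carrier[OF assms(1)] assms(2,3)])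

lemma inner_prod_lin_rep:
  assumes C: "gl3_rep n C" and u: "u \<in> carrier_vec n" and v: "v \<in> carrier_vec n"
  shows "inner_prod u (lin_rep n C m *\<^sub>v v) =
    (\<Sum>i\<in>{1..3}. \<Sum>j\<in>{1..3}. m i j * inner_prod u (C i j *\<^sub>v v))"
proof -
  let ?I = "{1..3} :: nat set"
  have car: "C i j \<in> carrier_mat n n" if "i \<in> ?I" "j \<in> ?I" for i j
    using C that by (auto simp: gl3_rep_def)
  have "inner_prod u (lin_rep n C m *\<^sub>v v) =
      (\<Sum>p<n. \<Sum>q<n. (\<Sum>i\<in>?I. \<Sum>j\<in>?I. m i j * C i j $$ (p, q)) * v $ q * cnj (u $ p))"
    unfolding inner_prod_mult_mat_vec[OF lin_rep_carrier u v]
    by (intro sum.cong refl) (simp add: lin_rep_def)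
  also have "\<dots> = (\<Sum>p<n. \<Sum>q<n. \<Sum>i\<in>?I. \<Sum>j\<in>?I. m i j * (C i j $$ (p, q) * v $ q * cnj (u $ p)))"
    by (simp only: sum_distrib_right mult.assoc)
  also have "\<dots> = (\<Sum>i\<in>?I. \<Sum>j\<in>?I. \<Sum>p<n. \<Sum>q<n. m i j * (C i j $$ (p, q) * v $ q * cnj (u $ p)))"
    by (rule sum_swap_pairs)
  also have "\<dots> = (\<Sum>i\<in>?I. \<Sum>j\<in>?I. m i j * inner_prod u (C i j *\<^sub>v v))"
    by (intro sum.cong refl) (simp only: inner_prod_mult_mat_vec[OF car u v] sum_distrib_left)
  finally show ?thesis .
qed

lemma diff_op_coherent_fun:
  assumes rep: "highest_weight_irrep w n C \<phi>" and psi: "\<psi> \<in> carrier_vec n"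
    and ij: "i \<in> {1..3}" "j \<in> {1..3}"
  shows "diff_op (zeroth_order_coeff w i j) (first_order_coeff i j) (coherent_fun C \<phi> \<psi>) =
    coherent_fun C \<phi> (C i j *\<^sub>v \<psi>)"
proof
  fix z
  let ?I = "{1..3} :: nat set"
  let ?L = "lin_rep n C"
  define f where "f = coherent_fun C \<phi> \<psi>"
  \<comment> \<open>Once \<open>V_plus C z\<close> has been absorbed into \<open>x\<close>, both
    sides are combinations of the nine numbers \<open>g k l\<close>.\<close>
  define x where "x = V_plus C z *\<^sub>v \<psi>"
  define g where "g k l = inner_prod \<phi> (C k l *\<^sub>v x)" for k l
  have C: "gl3_rep n C" and phi: "\<phi> \<in> carrier_vec n"
    and high: "\<And>k l. k \<in> ?I \<Longrightarrow> l \<in> ?I \<Longrightarrow> k < l \<Longrightarrow> C k l *\<^sub>v \<phi> = 0\<^sub>v n"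
    and weight: "\<And>k. k \<in> ?I \<Longrightarrow> C k k *\<^sub>v \<phi> = complex_of_real (w k) \<cdot>\<^sub>v \<phi>"
    and adj: "\<And>k l. k \<in> ?I \<Longrightarrow> l \<in> ?I \<Longrightarrow> mat_adjoint (C k l) = C l k"
    using rep by (auto simp: highest_weight_irrep_def irreducible_rep_def unitary_rep_def
        highest_weight_vector_def)
  have car: "C k l \<in> carrier_mat n n" if "k \<in> ?I" "l \<in> ?I" for k l
    using C that by (auto simp: gl3_rep_def)
  note V = V_plus_carrier[OF C]
  have x: "x \<in> carrier_vec n"
    unfolding x_def by (rule mult_mat_vec_carrier[OF V psi])
  have f: "f z = inner_prod \<phi> x"
    by (simp add: f_def x_def coherent_fun_eq[OF C phi psi])
  have adjoint: "g k l = inner_prod (C l k *\<^sub>v \<phi>) x" if "k \<in> ?I" "l \<in> ?I" for k l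
    using inner_prod_adjoint[OF car[OF that] phi x] adj[OF that] by (simp add: g_def)
  \<comment> \<open>The adjoint of a lowering generator is a raising one, which annihilates the
    highest weight vector.\<close>
  have low: "g k l = 0" if "k \<in> ?I" "l \<in> ?I" "l < k" for k l
    unfolding adjoint[OF that(1,2)] high[OF that(2,1,3)] using x by (simp add: inner_prod_def)
  \<comment> \<open>The weights are real, so moving them out of the antilinear argument does not
    conjugate them.\<close>
  have diag: "g k k = complex_of_real (w k) * f z" if "k \<in> ?I" for k
    unfolding adjoint[OF that that] weight[OF that] f using x phi
    by (simp add: inner_prod_def conjugate_smult_vec)
  have pd: "pderiv_coord \<alpha> f z = inner_prod \<phi> (?L m *\<^sub>v x)"
    if "entrywise_deriv n (\<lambda>s. V_plus C (z(\<alpha> := s))) (?L m * V_plus C z) (z \<alpha>)" for \<alpha> m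
    using DERIV_imp_deriv[OF entrywise_deriv_inner_prod[OF that V mult_carrier_mat[OF lin_rep_carrier V] phi psi]]
      lin_rep_carrier[of n C m] V[of z] psi
    by (simp add: pderiv_coord_def f_def coherent_fun_eq[OF C phi psi] x_def assoc_mult_mat_vec)
  have pd23: "pderiv_coord Z23 f z = g 2 3"
    unfolding pd[OF V_plus_deriv(1)[OF C]] inner_prod_lin_rep[OF C phi x]
    by (simp add: raising23_def g_def atLeastAtMost_1_3)
  have pd13: "pderiv_coord Z13 f z = g 1 3"
    unfolding pd[OF V_plus_deriv(2)[OF C]] inner_prod_lin_rep[OF C phi x]
    by (simp add: raising1_def g_def atLeastAtMost_1_3)
  have pd12: "pderiv_coord Z12 f z = g 1 2 - z Z23 * g 1 3"
    unfolding pd[OF V_plus_deriv(3)[OF C]] inner_prod_lin_rep[OF C phi x]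
    by (simp add: raising1_def g_def atLeastAtMost_1_3)
  let ?m = "\<lambda>k l. \<Sum>i'\<in>?I. \<Sum>j'\<in>?I. unipotent z k i' * unit3 i j i' j' * unipotent_inv z j' l"
  have m: "?m k l = unipotent z k i * unipotent_inv z j l" for k l
    using ij by (auto simp: unit3_def atLeastAtMost_1_3)
  have "coherent_fun C \<phi> (C i j *\<^sub>v \<psi>) z = inner_prod \<phi> (V_plus C z *\<^sub>v (C i j *\<^sub>v \<psi>))"
    by (rule coherent_fun_eq[OF C phi mult_mat_vec_carrier[OF car[OF ij] psi]])
  also have "V_plus C z *\<^sub>v (C i j *\<^sub>v \<psi>) = (V_plus C z * ?L (unit3 i j)) *\<^sub>v \<psi>"
    unfolding lin_rep_unit[OF C ij] by (rule assoc_mult_mat_vec[symmetric, OF V car[OF ij] psi])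
  also have "\<dots> = ?L ?m *\<^sub>v x"
    unfolding V_plus_conjugate[OF C] x_def by (rule assoc_mult_mat_vec[OF lin_rep_carrier V psi])
  also have "inner_prod \<phi> (?L ?m *\<^sub>v x) =
      (\<Sum>k\<in>?I. \<Sum>l\<in>?I. unipotent z k i * unipotent_inv z j l * g k l)"
    unfolding inner_prod_lin_rep[OF C phi x] m g_def ..
  \<comment> \<open>The z23 term in the coefficient of \<open>Z13\<close> cancels the -z23
    \<open>g 1 3\<close> contained in the z12 derivative.\<close>
  also have "\<dots> = diff_op (zeroth_order_coeff w i j) (first_order_coeff i j) f z"
    unfolding diff_op_def zeroth_order_coeff_def first_order_coeff_def
    by (simp add: pd12 pd13 pd23 atLeastAtMost_1_3 low diag[of "Suc 0", simplified]
        diag[of 2, simplified] diag[of 3, simplified] algebra_simps)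
  finally show "diff_op (zeroth_order_coeff w i j) (first_order_coeff i j) (coherent_fun C \<phi> \<psi>) z =
      coherent_fun C \<phi> (C i j *\<^sub>v \<psi>) z"
    by (simp add: f_def)
qed

lemma first_order_coeffs_first_order_coeff:
  assumes "i \<in> {1..3}" "j \<in> {1..3}"
  shows "first_order_coeffs i j (first_order_coeff i j)"
  unfolding first_order_coeffs_def
  using polynomial_fun_first_order_coeff polynomial_fun_zeroth_order_coeff
    diff_op_coherent_fun[OF _ _ assms] by blast

section \<open>The defining representation and its contragredient\<close>

lemma matrix_unit_carrier: "matrix_unit i j \<in> carrier_mat 3 3"
  by (simp add: matrix_unit_def)

lemma matrix_unit_mult:
  assumes "j \<in> {1..3}" "k \<in> {1..3}"
  shows "matrix_unit i j * matrix_unit k l = (if j = k then matrix_unit i l else 0\<^sub>m 3 3)"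
proof (rule eq_matI)
  fix p q
  assume "p < dim_row (if j = k then matrix_unit i l else 0\<^sub>m 3 3)"
    "q < dim_col (if j = k then matrix_unit i l else 0\<^sub>m 3 3)"
  then have pq: "p < 3" "q < 3"
    by (simp_all add: matrix_unit_def split: if_splits)
  \<comment> \<open>Generators count from 1 and matrix entries from 0, so the only contributing
    column is \<open>j - 1\<close>.\<close>
  have "(matrix_unit i j * matrix_unit k l) $$ (p, q) =
      (\<Sum>r<3. if r = j - 1 then (if Suc p = i \<and> j = k \<and> Suc q = l then 1 else 0) else 0)"
    unfolding mult_mat_entry[OF matrix_unit_carrier matrix_unit_carrier pq]
    using pq assms by (intro sum.cong refl) (auto simp: matrix_unit_def)
  also have "\<dots> = (if Suc p = i \<and> j = k \<and> Suc q = l then 1 else 0)"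
    using assms by auto
  finally show "(matrix_unit i j * matrix_unit k l) $$ (p, q) =
      (if j = k then matrix_unit i l else 0\<^sub>m 3 3) $$ (p, q)"
    using pq by (simp add: matrix_unit_def del: index_mult_mat(1))
qed (simp_all add: matrix_unit_def)

lemma matrix_unit_mult_vec:
  assumes "v \<in> carrier_vec 3" "j \<in> {1..3}"
  shows "matrix_unit i j *\<^sub>v v = vec 3 (\<lambda>p. if Suc p = i then v $ (j - 1) else 0)"
proof (rule eq_vecI)
  fix p assume p: "p < dim_vec (vec 3 (\<lambda>p. if Suc p = i then v $ (j - 1) else 0))"
  have "(matrix_unit i j *\<^sub>v v) $ p = (\<Sum>r<3. matrix_unit i j $$ (p, r) * v $ r)"
    using p assms by (simp add: matrix_unit_def scalar_prod_def atLeast0LessThan)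
  also have "\<dots> = (\<Sum>r<3. if r = j - 1 then (if Suc p = i then v $ (j - 1) else 0) else 0)"
    using p assms by (intro sum.cong refl) (auto simp: matrix_unit_def)
  also have "\<dots> = (if Suc p = i then v $ (j - 1) else 0)"
    using assms by auto
  finally show "(matrix_unit i j *\<^sub>v v) $ p = vec 3 (\<lambda>p. if Suc p = i then v $ (j - 1) else 0) $ p"
    using p by simp
qed (simp add: matrix_unit_def)

lemma mat_adjoint_matrix_unit: "mat_adjoint (matrix_unit i j) = matrix_unit j i"
  by (rule eq_matI) (auto simp: matrix_unit_def mat_adjoint_def mat_of_rows_def)

text \<open>The contragredient of the defining representation, as negative transpose: transposition
  reverses products, and the sign restores the bracket.\<close>

definition dual_unit :: generators where
  "dual_unit i j = - matrix_unit j i"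

lemma dual_unit_carrier: "dual_unit i j \<in> carrier_mat 3 3"
  by (simp add: dual_unit_def matrix_unit_carrier)

text \<open>If the coordinate \<open>k\<close> of some vector in \<open>W\<close> is nonzero, the
  matrix units taking \<open>k\<close> to \<open>p\<close> produce a nonzero multiple of every basis
  vector. The contragredient reuses this, its generators being matrix units up to sign.\<close>

lemma subspace_matrix_units_trivial:
  assumes W: "VectorSpace.subspace class_ring W (module_vec TYPE(complex) 3)"
    and inv: "\<And>i j v. i \<in> {1..3} \<Longrightarrow> j \<in> {1..3} \<Longrightarrow> v \<in> W \<Longrightarrow> matrix_unit i j *\<^sub>v v \<in> W"
  shows "W = {0\<^sub>v 3} \<or> W = carrier_vec 3"
proof -
  have sub: "submodule class_ring W (module_vec TYPE(complex) 3)"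
    using W by (simp add: VectorSpace.subspace_def)
  have W_carrier: "W \<subseteq> carrier_vec 3"
    and W_add: "\<And>u v. u \<in> W \<Longrightarrow> v \<in> W \<Longrightarrow> u + v \<in> W"
    and W_zero: "0\<^sub>v 3 \<in> W"
    and W_smult: "\<And>c v. v \<in> W \<Longrightarrow> c \<cdot>\<^sub>v v \<in> W"
    using submodule.subset[OF sub] submodule.m_closed[OF sub] submodule.zero_closed[OF sub]
      submodule.smult_closed[OF sub]
    by (simp_all add: module_vec_simps)
  show ?thesis
  proof (cases "W = {0\<^sub>v 3}")
    case False
    then obtain v where v: "v \<in> W" "v \<noteq> 0\<^sub>v 3"
      using W_zero by blast
    then have vc: "v \<in> carrier_vec 3"
      using W_carrier by blast
    then obtain k where k: "k < 3" "v $ k \<noteq> 0"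
      using v(2) by (metis eq_vecI carrier_vecD index_zero_vec)
    have e: "unit_vec 3 p \<in> W" if "p < 3" for p
    proof -
      have "matrix_unit (Suc p) (Suc k) *\<^sub>v v = v $ k \<cdot>\<^sub>v unit_vec 3 p"
        using k that by (subst matrix_unit_mult_vec[OF vc]) (auto intro!: eq_vecI)
      then have "v $ k \<cdot>\<^sub>v unit_vec 3 p \<in> W"
        using inv[of "Suc p" "Suc k" v] k that v by simp
      from W_smult[OF this, of "inverse (v $ k)"] show ?thesis
        using k by (simp add: smult_smult_assoc)
    qed
    have "u \<in> W" if u: "u \<in> carrier_vec 3" for u
    proof -
      have "u = u $ 0 \<cdot>\<^sub>v unit_vec 3 0 + (u $ 1 \<cdot>\<^sub>v unit_vec 3 1 + u $ 2 \<cdot>\<^sub>v unit_vec 3 2)"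
      proof (rule eq_vecI)
        fix p assume "p < dim_vec (u $ 0 \<cdot>\<^sub>v unit_vec 3 0 + (u $ 1 \<cdot>\<^sub>v unit_vec 3 1 + u $ 2 \<cdot>\<^sub>v unit_vec 3 2))"
        then have "p = 0 \<or> p = 1 \<or> p = 2"
          by auto
        then show "u $ p = (u $ 0 \<cdot>\<^sub>v unit_vec 3 0 + (u $ 1 \<cdot>\<^sub>v unit_vec 3 1 + u $ 2 \<cdot>\<^sub>v unit_vec 3 2)) $ p"
          by auto
      qed (use u in auto)
      also have "\<dots> \<in> W"
        using e by (intro W_add W_smult) auto
      finally show ?thesis .
    qed
    then show ?thesis
      using W_carrier by blast
  qed simp
qed

lemma gl3_rep_matrix_unit: "gl3_rep 3 matrix_unit"
  unfolding gl3_rep_def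
  by (auto simp: matrix_unit_mult matrix_unit_carrier)

lemma gl3_rep_dual_unit: "gl3_rep 3 dual_unit"
proof -
  have mult: "dual_unit i j * dual_unit k l = (if i = l then matrix_unit j k else 0\<^sub>m 3 3)"
    if "i \<in> {1..3}" "l \<in> {1..3}" for i j k l
    unfolding dual_unit_def using that
    by (simp add: uminus_mult_left_mat uminus_mult_right_mat matrix_unit_mult carrier_matD[OF matrix_unit_carrier])
  show ?thesis
    unfolding gl3_rep_def
  proof (intro conjI ballI)
    fix i j k l :: nat
    assume ijkl: "i \<in> {1..3}" "j \<in> {1..3}" "k \<in> {1..3}" "l \<in> {1..3}"
    show "dual_unit i j * dual_unit k l - dual_unit k l * dual_unit i j =
        (if j = k then dual_unit i l else 0\<^sub>m 3 3) - (if i = l then dual_unit k j else 0\<^sub>m 3 3)"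
      unfolding mult[OF ijkl(1,4)] mult[OF ijkl(3,2)]
      unfolding dual_unit_def
      by (rule eq_matI) (auto simp: matrix_unit_def)
  qed (rule dual_unit_carrier)
qed

lemma highest_weight_irrep_matrix_unit:
  "highest_weight_irrep (\<lambda>k. if k = 1 then 1 else 0) 3 matrix_unit (unit_vec 3 0)"
  unfolding highest_weight_irrep_def
proof (intro conjI)
  show "irreducible_rep 3 matrix_unit"
    unfolding irreducible_rep_def
    using gl3_rep_matrix_unit subspace_matrix_units_trivial by auto
  show "unitary_rep matrix_unit"
    by (simp add: unitary_rep_def mat_adjoint_matrix_unit)
  show "highest_weight_vector 3 matrix_unit (\<lambda>k. if k = 1 then 1 else 0) (unit_vec 3 0)"
    unfolding highest_weight_vector_def
    by (auto simp: matrix_unit_mult_vec inner_prod_def intro!: eq_vecI)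
qed

lemma highest_weight_irrep_dual_unit:
  "highest_weight_irrep (\<lambda>k. if k = 3 then - 1 else 0) 3 dual_unit (unit_vec 3 2)"
  unfolding highest_weight_irrep_def
proof (intro conjI)
  have dual_vec: "dual_unit i j *\<^sub>v v = - (matrix_unit j i *\<^sub>v v)" if "v \<in> carrier_vec 3" for i j v
    using that by (simp add: dual_unit_def uminus_mult_mat_vec carrier_matD[OF matrix_unit_carrier])
  show "irreducible_rep 3 dual_unit"
    unfolding irreducible_rep_def
  proof (intro conjI allI impI)
    fix W
    assume W: "VectorSpace.subspace class_ring W (module_vec TYPE(complex) 3)"
      and inv: "\<forall>i\<in>{1..3}. \<forall>j\<in>{1..3}. \<forall>v\<in>W. dual_unit i j *\<^sub>v v \<in> W"
    have sub: "submodule class_ring W (module_vec TYPE(complex) 3)"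
      using W by (simp add: VectorSpace.subspace_def)
    show "W = {0\<^sub>v 3} \<or> W = carrier_vec 3"
    proof (rule subspace_matrix_units_trivial[OF W])
      fix i j :: nat and v assume ij: "i \<in> {1..3}" "j \<in> {1..3}" and v: "v \<in> W"
      have vc: "v \<in> carrier_vec 3"
        using submodule.subset[OF sub] v by (auto simp: module_vec_simps)
      \<comment> \<open>Invariance is assumed for negated transposed units; swapping the indices and
        scaling by -1 recovers \<open>matrix_unit i j\<close>.\<close>
      have "(- 1) \<cdot>\<^sub>v (dual_unit j i *\<^sub>v v) \<in> W"
        using submodule.smult_closed[OF sub, of "- 1"] inv ij v by (auto simp: module_vec_simps)
      moreover have "(- 1) \<cdot>\<^sub>v (dual_unit j i *\<^sub>v v) = matrix_unit i j *\<^sub>v v"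
        unfolding dual_vec[OF vc] by (rule eq_vecI) auto
      ultimately show "matrix_unit i j *\<^sub>v v \<in> W"
        by simp
    qed
  qed (simp_all add: gl3_rep_dual_unit)
  show "unitary_rep dual_unit"
    unfolding unitary_rep_def dual_unit_def
    by (intro ballI eq_matI) (auto simp: matrix_unit_def mat_adjoint_def mat_of_rows_def)
  show "highest_weight_vector 3 dual_unit (\<lambda>k. if k = 3 then - 1 else 0) (unit_vec 3 2)"
    unfolding highest_weight_vector_def
    by (auto simp: dual_vec matrix_unit_mult_vec inner_prod_def intro!: eq_vecI)
qed

lemma inner_prod_unit_vec:
  assumes A: "A \<in> carrier_mat n n" and pq: "p < n" "q < n"
  shows "inner_prod (unit_vec n p) (A *\<^sub>v unit_vec n q) = A $$ (p, q)"
proof -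
  have "inner_prod (unit_vec n p) (A *\<^sub>v unit_vec n q) =
      (\<Sum>p'<n. \<Sum>q'<n. if p' = p then if q' = q then A $$ (p, q) else 0 else 0)"
    unfolding inner_prod_mult_mat_vec[OF A unit_vec_carrier unit_vec_carrier]
    using pq by (intro sum.cong refl) auto
  then show ?thesis
    using pq by (simp add: sum_if_zero)
qed

text \<open>The highest weight vector is the first basis vector, so the coherent functions are the
  entries of the first row of V'.\<close>

lemma coherent_fun_matrix_unit:
  "coherent_fun matrix_unit (unit_vec 3 0) (unit_vec 3 0) = (\<lambda>z. 1)"
  "coherent_fun matrix_unit (unit_vec 3 0) (unit_vec 3 1) = (\<lambda>z. z Z12)"
  "coherent_fun matrix_unit (unit_vec 3 0) (unit_vec 3 2) = (\<lambda>z. z Z13)"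
proof -
  have "coherent_fun matrix_unit (unit_vec 3 0) (unit_vec 3 q) z = V_plus matrix_unit z $$ (0, q)"
    if "q < 3" for q z
    using coherent_fun_eq[OF gl3_rep_matrix_unit unit_vec_carrier unit_vec_carrier]
      inner_prod_unit_vec[OF V_plus_carrier[OF gl3_rep_matrix_unit]] that by simp
  then show "coherent_fun matrix_unit (unit_vec 3 0) (unit_vec 3 0) = (\<lambda>z. 1)"
    "coherent_fun matrix_unit (unit_vec 3 0) (unit_vec 3 1) = (\<lambda>z. z Z12)"
    "coherent_fun matrix_unit (unit_vec 3 0) (unit_vec 3 2) = (\<lambda>z. z Z13)"
    by (simp_all add: fun_eq_iff V_plus_matrix_units mat_of_rows_list_def)
qed

text \<open>Here V' is represented by its inverse transpose and the highest weight vector is the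
  third basis vector. The functions are thus the entries of the last column of the inverse of V',
  among which -z23 stands alone.\<close>

lemma coherent_fun_dual_unit:
  "coherent_fun dual_unit (unit_vec 3 2) (unit_vec 3 2) = (\<lambda>z. 1)"
  "coherent_fun dual_unit (unit_vec 3 2) (unit_vec 3 1) = (\<lambda>z. - z Z23)"
proof -
  have set3: "{0..<3::nat} = {0, 1, 2}"
    by auto
  have lt3: "i < 3 \<longleftrightarrow> i = 0 \<or> i = 1 \<or> i = (2::nat)" for i
    by auto
  have V: "V_plus dual_unit z $$ (2, q) = (if q = 2 then 1 else if q = 1 then - z Z23 else z Z12 * z Z23 - z Z13)"
    if q: "q < 3" for z q
  proof -
    let ?A = "z Z23 \<cdot>\<^sub>m dual_unit 2 3"
    let ?B = "z Z12 \<cdot>\<^sub>m dual_unit 1 2 + z Z13 \<cdot>\<^sub>m dual_unit 1 3"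
    have "?A * ?A = 0\<^sub>m 3 3"
      by (rule eq_matI) (auto simp: dual_unit_def matrix_unit_def scalar_prod_def set3 lt3)
    then have eA: "mat_exp ?A = 1\<^sub>m 3 + ?A"
      by (intro mat_exp_square_zero) (simp_all add: dual_unit_carrier)
    have "?B * ?B = 0\<^sub>m 3 3"
      by (rule eq_matI) (auto simp: dual_unit_def matrix_unit_def scalar_prod_def set3 lt3)
    then have eB: "mat_exp ?B = 1\<^sub>m 3 + ?B"
      by (intro mat_exp_square_zero) (simp_all add: dual_unit_carrier)
    have "q = 0 \<or> q = 1 \<or> q = 2"
      using q by auto
    then show ?thesis
      unfolding V_plus_def eA eB
      by (elim disjE) (simp_all add: dual_unit_def matrix_unit_def scalar_prod_def set3)
  qed
  have "coherent_fun dual_unit (unit_vec 3 2) (unit_vec 3 q) z = V_plus dual_unit z $$ (2, q)"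
    if "q < 3" for q z
    using coherent_fun_eq[OF gl3_rep_dual_unit unit_vec_carrier unit_vec_carrier]
      inner_prod_unit_vec[OF V_plus_carrier[OF gl3_rep_dual_unit]] that by simp
  then show "coherent_fun dual_unit (unit_vec 3 2) (unit_vec 3 2) = (\<lambda>z. 1)"
    "coherent_fun dual_unit (unit_vec 3 2) (unit_vec 3 1) = (\<lambda>z. - z Z23)"
    by (simp_all add: fun_eq_iff V)
qed

section \<open>Uniqueness of the first order coefficients\<close>

lemma pderiv_coord_const: "pderiv_coord \<alpha> (\<lambda>z. c) z = 0"
  by (simp add: pderiv_coord_def)

lemma pderiv_coord_coord: "pderiv_coord \<alpha> (\<lambda>z. z \<beta>) z = (if \<alpha> = \<beta> then 1 else 0)"
  by (simp add: pderiv_coord_def)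

lemma pderiv_coord_uminus_coord: "pderiv_coord \<alpha> (\<lambda>z. - z \<beta>) z = (if \<alpha> = \<beta> then - 1 else 0)"
  by (auto simp: pderiv_coord_def intro!: DERIV_imp_deriv derivative_eq_intros)

lemma first_order_coeffs_unique:
  assumes Q: "first_order_coeffs i j Q" and Q': "first_order_coeffs i j Q'"
  shows "Q = Q'"
proof -
  \<comment> \<open>\<open>P\<close> and \<open>P'\<close> are chosen after the weight but before
    the vector, so one pair serves all functions of the representation.\<close>
  have same: "\<exists>P P'. \<forall>\<psi>\<in>carrier_vec n.
      diff_op P Q (coherent_fun C \<phi> \<psi>) = diff_op P' Q' (coherent_fun C \<phi> \<psi>)"
    if "admissible_weight w" "highest_weight_irrep w n C \<phi>" for w n C \<phi>
    using Q Q' that unfolding first_order_coeffs_def by metis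
  have "admissible_weight (\<lambda>k. if k = 1 then 1 else 0)"
    by (simp add: admissible_weight_def)
  from same[OF this highest_weight_irrep_matrix_unit] obtain P P' where
    "\<forall>\<psi>\<in>carrier_vec 3. diff_op P Q (coherent_fun matrix_unit (unit_vec 3 0) \<psi>) =
      diff_op P' Q' (coherent_fun matrix_unit (unit_vec 3 0) \<psi>)"
    by blast
  then have f: "diff_op P Q (coherent_fun matrix_unit (unit_vec 3 0) (unit_vec 3 q)) =
      diff_op P' Q' (coherent_fun matrix_unit (unit_vec 3 0) (unit_vec 3 q))" for q
    by simp
  \<comment> \<open>On the constant function 1 the derivatives drop out and only the zeroth order
    coefficients are compared.\<close>
  have P: "P z = P' z" for z
    using fun_cong[OF f[of 0], of z] unfolding coherent_fun_matrix_unit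
    by (simp add: diff_op_def pderiv_coord_const)
  have Q12: "Q Z12 z = Q' Z12 z" for z
    using fun_cong[OF f[of 1], of z] P[of z] unfolding coherent_fun_matrix_unit
    by (simp add: diff_op_def pderiv_coord_coord)
  have Q13: "Q Z13 z = Q' Z13 z" for z
    using fun_cong[OF f[of 2], of z] P[of z] unfolding coherent_fun_matrix_unit
    by (simp add: diff_op_def pderiv_coord_coord)
  have "admissible_weight (\<lambda>k. if k = 3 then - 1 else 0)"
    by (simp add: admissible_weight_def)
  from same[OF this highest_weight_irrep_dual_unit] obtain R R' where
    "\<forall>\<psi>\<in>carrier_vec 3. diff_op R Q (coherent_fun dual_unit (unit_vec 3 2) \<psi>) =
      diff_op R' Q' (coherent_fun dual_unit (unit_vec 3 2) \<psi>)"
    by blast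
  then have g: "diff_op R Q (coherent_fun dual_unit (unit_vec 3 2) (unit_vec 3 q)) =
      diff_op R' Q' (coherent_fun dual_unit (unit_vec 3 2) (unit_vec 3 q))" for q
    by simp
  have R: "R z = R' z" for z
    using fun_cong[OF g[of 2], of z] unfolding coherent_fun_dual_unit
    by (simp add: diff_op_def pderiv_coord_const)
  have Q23: "Q Z23 z = Q' Z23 z" for z
    using fun_cong[OF g[of 1], of z] R[of z] unfolding coherent_fun_dual_unit
    by (simp add: diff_op_def pderiv_coord_uminus_coord)
  show ?thesis
  proof (intro ext)
    fix \<alpha> z
    show "Q \<alpha> z = Q' \<alpha> z"
      by (cases \<alpha>) (simp_all add: Q12 Q13 Q23)
  qed
qed

lemma Q_coeff_eq:
  assumes "i \<in> {1..3}" "j \<in> {1..3}"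
  shows "Q_coeff i j = first_order_coeff i j"
  unfolding Q_coeff_def
  using first_order_coeffs_first_order_coeff[OF assms] first_order_coeffs_unique by blast

text \<open>With A = V' \<epsilon> V'^(-1), the three right-hand sides are A_12, A_13 + z23 A_12 and
  A_23. In the second, the combination of columns of the inverse has entries -z13, 0, 1, so z23
  cancels and the second column of \<epsilon> does not appear.\<close>

theorem proposition4:
  fixes \<epsilon> :: "nat \<Rightarrow> nat \<Rightarrow> complex"
    and z :: "real \<Rightarrow> coord \<Rightarrow> complex"
    and z' :: "coord \<Rightarrow> complex"
    and t :: real
  assumes "hermitian_coeffs \<epsilon>"
    and "\<And>\<alpha>. ((\<lambda>s. z s \<alpha>) has_vector_derivative z' \<alpha>) (at t)"
  shows "equations_of_motion \<epsilon> (z t) z' \<longleftrightarrow>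
    \<i> * z' Z12 = - \<epsilon> 1 1 * z t Z12 + \<epsilon> 1 2 - \<epsilon> 2 1 * (z t Z12)^2 + \<epsilon> 2 2 * z t Z12
      - \<epsilon> 3 1 * z t Z12 * z t Z13 + \<epsilon> 3 2 * z t Z13 \<and>
    \<i> * z' Z13 = - \<epsilon> 1 1 * z t Z13 + \<epsilon> 1 3 - \<epsilon> 2 1 * z t Z12 * z t Z13 + \<epsilon> 2 3 * z t Z12
      - \<epsilon> 3 1 * (z t Z13)^2 + \<epsilon> 3 3 * z t Z13 \<and>
    \<i> * z' Z23 = \<epsilon> 2 1 * (z t Z12 * z t Z23 - z t Z13) - \<epsilon> 2 2 * z t Z23 + \<epsilon> 2 3
      + \<epsilon> 3 1 * (z t Z12 * z t Z23 - z t Z13) * z t Z23 - \<epsilon> 3 2 * (z t Z23)^2 + \<epsilon> 3 3 * z t Z23"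
proof -
  have all_coord: "(\<forall>\<alpha>. R \<alpha>) \<longleftrightarrow> R Z12 \<and> R Z13 \<and> R Z23" for R
    by (metis coord.exhaust)
  have sum_eq: "(\<Sum>i\<in>{1..3}. \<Sum>j\<in>{1..3}. \<epsilon> i j * Q_coeff i j \<alpha> (z t)) =
      (\<Sum>i\<in>{1..3}. \<Sum>j\<in>{1..3}. \<epsilon> i j * first_order_coeff i j \<alpha> (z t))" for \<alpha>
    by (intro sum.cong refl) (simp only: Q_coeff_eq)
  have "(\<Sum>i\<in>{1..3}. \<Sum>j\<in>{1..3}. \<epsilon> i j * Q_coeff i j Z12 (z t)) =
      - \<epsilon> 1 1 * z t Z12 + \<epsilon> 1 2 - \<epsilon> 2 1 * (z t Z12)^2 + \<epsilon> 2 2 * z t Z12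
      - \<epsilon> 3 1 * z t Z12 * z t Z13 + \<epsilon> 3 2 * z t Z13"
    unfolding sum_eq
    by (simp add: first_order_coeff_def unipotent_def unipotent_inv_def atLeastAtMost_1_3
        power2_eq_square algebra_simps)
  moreover have "(\<Sum>i\<in>{1..3}. \<Sum>j\<in>{1..3}. \<epsilon> i j * Q_coeff i j Z13 (z t)) =
      - \<epsilon> 1 1 * z t Z13 + \<epsilon> 1 3 - \<epsilon> 2 1 * z t Z12 * z t Z13 + \<epsilon> 2 3 * z t Z12
      - \<epsilon> 3 1 * (z t Z13)^2 + \<epsilon> 3 3 * z t Z13"
    unfolding sum_eq
    by (simp add: first_order_coeff_def unipotent_def unipotent_inv_def atLeastAtMost_1_3
        power2_eq_square algebra_simps)
  moreover have "(\<Sum>i\<in>{1..3}. \<Sum>j\<in>{1..3}. \<epsilon> i j * Q_coeff i j Z23 (z t)) =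
      \<epsilon> 2 1 * (z t Z12 * z t Z23 - z t Z13) - \<epsilon> 2 2 * z t Z23 + \<epsilon> 2 3
      + \<epsilon> 3 1 * (z t Z12 * z t Z23 - z t Z13) * z t Z23 - \<epsilon> 3 2 * (z t Z23)^2 + \<epsilon> 3 3 * z t Z23"
    unfolding sum_eq
    by (simp add: first_order_coeff_def unipotent_def unipotent_inv_def atLeastAtMost_1_3
        power2_eq_square algebra_simps)
  ultimately show ?thesis
    unfolding equations_of_motion_def all_coord by simp
qed

end
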